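(* There are positive real numbers $\lambda>\mu>\mu'$ such that there exists a thinning on $[0,1]$ from $\lambda$ to $\mu$, but there does not exist a thinning on $[0,1]$ from $\lambda$ to $\mu'$.
   Context: Point processes on $[0,1]$ are viewed as random simple point measures on $[0,1]$ (finite $\{0,1,2,\dots\}$-valued measures with mass at most one at each point), with the $\sigma$-algebra generated by the maps $\nu\mapsto\nu(A)$, $A$ Borel. For $\lambda>\mu>0$, a (deterministic, Poisson) thinning from $\lambda$ to $\mu$ on $[0,1]$ is a measurable function $f$ from the set of simple point measures on $[0,1]$ to itself such that, if $\Pi$ is a homogeneous Poisson point process of intensity $\lambda$ on $[0,1]$ (with respect to Lebesgue measure), then $f(\Pi)$ is a homogeneous Poisson point process of intensity $\mu$ on $[0,1]$, and every point of $f(\Pi)$ is a point of $\Pi$ almost surely. *)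

theory Defs
  imports "HOL-Probability.Probability"
begin

abbreviation unit_borel :: "real measure" where
  "unit_borel \<equiv> restrict_space borel {0..1}"

(* The second condition makes the measure finite, since it applies to A = {0..1}. *)
definition simple_point_measures :: "real measure set" where
  "simple_point_measures =
     {\<nu>. sets \<nu> = sets unit_borel \<and>
          (\<forall>A\<in>sets unit_borel. \<exists>n::nat. emeasure \<nu> A = of_nat n) \<and>
          (\<forall>x\<in>{0..1}. emeasure \<nu> {x} \<le> 1)}"

definition point_space :: "real measure measure" where
  "point_space =
     sigma simple_point_measures
       {{\<nu> \<in> simple_point_measures. emeasure \<nu> A \<in> B} | A B.
          A \<in> sets unit_borel \<and> B \<in> sets borel}"

definition points :: "real measure \<Rightarrow> real set" where
  "points \<nu> = {x\<in>{0..1}. emeasure \<nu> {x} \<noteq> 0}"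

(* The formula for the Poisson law is written out because poisson_pmf is only
   specified for positive rates, whereas A may be a null set. *)
definition poisson_process :: "real \<Rightarrow> 'a measure \<Rightarrow> ('a \<Rightarrow> real measure) \<Rightarrow> bool" where
  "poisson_process r M X \<longleftrightarrow>
     prob_space M \<and>
     X \<in> measurable M point_space \<and>
     (\<forall>A\<in>sets unit_borel. \<forall>n::nat.
        measure M {\<omega>\<in>space M. emeasure (X \<omega>) A = of_nat n} =
          (r * measure lborel A) ^ n / fact n * exp (- (r * measure lborel A))) \<and>
     (\<forall>(n::nat) A. (\<forall>i<n. A i \<in> sets unit_borel) \<and> disjoint_family_on A {..<n} \<longrightarrow>
        prob_space.indep_vars M (\<lambda>_. borel) (\<lambda>i \<omega>. emeasure (X \<omega>) (A i)) {..<n})"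

(* The probability space carrying the process has sample points of type real measure,
   because a definition cannot quantify over types. Nothing is lost: this type carries the
   law of every process, and thinning_any_space transfers the property to all other types. *)
definition thinning :: "real \<Rightarrow> real \<Rightarrow> (real measure \<Rightarrow> real measure) \<Rightarrow> bool" where
  "thinning r s f \<longleftrightarrow>
     f \<in> measurable point_space point_space \<and>
     (\<forall>(M :: real measure measure) X. poisson_process r M X \<longrightarrow>
        poisson_process s M (\<lambda>\<omega>. f (X \<omega>)) \<and>
        (AE \<omega> in M. points (f (X \<omega>)) \<subseteq> points (X \<omega>)))"

lemma space_point_space: "space point_space = simple_point_measures"
  unfolding point_space_def by (rule space_measure_of) auto

lemma measurable_count:
  assumes "A \<in> sets unit_borel"
  shows "(\<lambda>\<nu>. emeasure \<nu> A) \<in> borel_measurable point_space"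
proof (rule measurableI)
  fix B :: "ennreal set" assume "B \<in> sets borel"
  then have "{\<nu> \<in> simple_point_measures. emeasure \<nu> A \<in> B} \<in> sets point_space"
    unfolding point_space_def using assms by (subst sets_measure_of) auto
  moreover have "(\<lambda>\<nu>. emeasure \<nu> A) -` B \<inter> space point_space =
      {\<nu> \<in> simple_point_measures. emeasure \<nu> A \<in> B}"
    by (auto simp: space_point_space)
  ultimately show "(\<lambda>\<nu>. emeasure \<nu> A) -` B \<inter> space point_space \<in> sets point_space"
    by simp
qed simp

lemma poisson_process_distr_iff:
  assumes M: "prob_space M" and X: "X \<in> measurable M point_space"
    and g: "g \<in> measurable point_space point_space"
  shows "poisson_process r (distr M point_space X) g \<longleftrightarrow> poisson_process r M (\<lambda>\<omega>. g (X \<omega>))"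
proof -
  let ?D = "distr M point_space X"
  have D: "prob_space ?D" by (rule prob_space.prob_space_distr[OF M X])
  have gX: "(\<lambda>\<omega>. g (X \<omega>)) \<in> measurable M point_space"
    using measurable_comp[OF X g] by (simp add: o_def)
  have c: "(\<lambda>\<nu>. emeasure (g \<nu>) A) \<in> borel_measurable point_space" if "A \<in> sets unit_borel" for A
    using measurable_comp[OF g measurable_count[OF that]] by (simp add: o_def)
  have eq1: "measure ?D {\<omega>\<in>space ?D. emeasure (g \<omega>) A = of_nat n} =
      measure M {\<omega>\<in>space M. emeasure (g (X \<omega>)) A = of_nat n}"
    if A: "A \<in> sets unit_borel" for A n
  proof -
    have "{\<omega>\<in>space point_space. emeasure (g \<omega>) A = of_nat n} \<in> sets point_space"
      using measurable_sets[OF c[OF A], of "{of_nat n}"] by (simp add: vimage_def Int_def conj_commute)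
    then show ?thesis
      using measurable_space[OF X] by (auto simp: measure_distr[OF X] intro!: arg_cong[of _ _ "measure M"])
  qed
  have eq2: "prob_space.indep_vars ?D (\<lambda>_. borel) (\<lambda>i \<omega>. emeasure (g \<omega>) (A i)) {..<n} \<longleftrightarrow>
      prob_space.indep_vars M (\<lambda>_. borel) (\<lambda>i \<omega>. emeasure (g (X \<omega>)) (A i)) {..<n}"
    if A: "\<forall>i<n. A i \<in> sets unit_borel" for A and n :: nat
  proof (cases "n = 0")
    case True
    then show ?thesis
      by (simp add: prob_space.indep_vars_def2[OF M] prob_space.indep_vars_def2[OF D]
          prob_space.indep_sets_def[OF M] prob_space.indep_sets_def[OF D])
  next
    case False
    then have ne: "{..<n} \<noteq> {}" by auto
    have ci: "\<And>i. i \<in> {..<n} \<Longrightarrow> (\<lambda>\<omega>. emeasure (g \<omega>) (A i)) \<in> borel_measurable point_space"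
      using A c by auto
    have cX: "\<And>i. i \<in> {..<n} \<Longrightarrow> (\<lambda>\<omega>. emeasure (g (X \<omega>)) (A i)) \<in> borel_measurable M"
      using measurable_comp[OF X ci] by (simp add: o_def)
    have cP: "(\<lambda>\<omega>. \<lambda>i\<in>{..<n}. emeasure (g \<omega>) (A i)) \<in>
        measurable point_space (Pi\<^sub>M {..<n} (\<lambda>_. borel))"
      by (rule measurable_restrict[OF ci])
    have eqP: "(\<Pi>\<^sub>M i\<in>{..<n}. distr ?D borel (\<lambda>\<omega>. emeasure (g \<omega>) (A i))) =
        (\<Pi>\<^sub>M i\<in>{..<n}. distr M borel (\<lambda>\<omega>. emeasure (g (X \<omega>)) (A i)))"
    proof (rule PiM_cong)
      fix i assume "i \<in> {..<n}"
      then show "distr ?D borel (\<lambda>\<omega>. emeasure (g \<omega>) (A i)) =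
          distr M borel (\<lambda>\<omega>. emeasure (g (X \<omega>)) (A i))"
        using distr_distr[OF ci X] by (simp add: o_def)
    qed simp
    have "?thesis \<longleftrightarrow> (distr ?D (Pi\<^sub>M {..<n} (\<lambda>_. borel)) (\<lambda>\<omega>. \<lambda>i\<in>{..<n}. emeasure (g \<omega>) (A i)) =
          (\<Pi>\<^sub>M i\<in>{..<n}. distr ?D borel (\<lambda>\<omega>. emeasure (g \<omega>) (A i))) \<longleftrightarrow>
        distr M (Pi\<^sub>M {..<n} (\<lambda>_. borel)) (\<lambda>\<omega>. \<lambda>i\<in>{..<n}. emeasure (g (X \<omega>)) (A i)) =
          (\<Pi>\<^sub>M i\<in>{..<n}. distr M borel (\<lambda>\<omega>. emeasure (g (X \<omega>)) (A i))))"
      using prob_space.indep_vars_iff_distr_eq_PiM'[OF D ne,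
          where M' = "\<lambda>_. borel" and X = "\<lambda>i \<omega>. emeasure (g \<omega>) (A i)"]
        prob_space.indep_vars_iff_distr_eq_PiM'[OF M ne,
          where M' = "\<lambda>_. borel" and X = "\<lambda>i \<omega>. emeasure (g (X \<omega>)) (A i)"] ci cX
      by simp
    then show ?thesis
      unfolding eqP distr_distr[OF cP X] o_def by simp
  qed
  show ?thesis
    unfolding poisson_process_def using M D g gX eq1 eq2
    by (simp cong: conj_cong)
qed

lemma thinning_any_space:
  fixes M :: "'a measure"
  assumes f: "thinning r s f" and P: "poisson_process r M X"
  shows "poisson_process s M (\<lambda>\<omega>. f (X \<omega>))"
    and "AE \<omega> in M. points (f (X \<omega>)) \<subseteq> points (X \<omega>)"
proof -
  have M: "prob_space M" and X: "X \<in> measurable M point_space"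
    using P by (auto simp: poisson_process_def)
  have fm: "f \<in> measurable point_space point_space" using f by (simp add: thinning_def)
  have "poisson_process r (distr M point_space X) (\<lambda>\<nu>. \<nu>)"
    using P by (subst poisson_process_distr_iff[OF M X]) simp_all
  then have 1: "poisson_process s (distr M point_space X) f"
    and 2: "AE \<nu> in distr M point_space X. points (f \<nu>) \<subseteq> points \<nu>"
    using f unfolding thinning_def by auto
  show "poisson_process s M (\<lambda>\<omega>. f (X \<omega>))"
    using 1 by (subst (asm) poisson_process_distr_iff[OF M X fm])
  show "AE \<omega> in M. points (f (X \<omega>)) \<subseteq> points (X \<omega>)"
    by (rule AE_distrD[OF X 2])
qed

end

theory Submission
  imports Defs
begin

text \<open>Let p and q be the weights of the Poisson distributions of parameters r and s. If a thinning
  from r to s keeps single points lying in a set A, then r exp(-r) \<le> s exp(-s) unless A is null; if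
  A is null, all configurations of at most one point are mapped to the empty one, so
  p 0 + p 1 \<le> q 0. Both inequalities fail for r = 3/2 and s = 3/5.

  For r = 3/2 and s = 13/20 one has p 1 \<le> q 1, so single points can always be kept. The missing mass
  q 1 - p 1 is taken from p 2, and q n from p (n + 1) for n \<ge> 2: from n + 1 points, either one point is
  deleted, such that the others are distributed like n independent uniform points, or all are. The
  randomness needed for this is extracted from the low-order digits of the points, which are
  independent of their order.\<close>

subsection \<open>Point measures as finite sets\<close>

text \<open>The probability \<open>x * exp (-x)\<close> of exactly one point is not monotone in
  \<open>x\<close>: it increases up to 1 and decreases afterwards. Its value at 3/2 is taken a
  second time near 0.626, and 13/20 lies just above that number, 3/5 just below. Below it the target
  process has fewer single points than the given one, but a configuration with the single point u
  offers no randomness besides u, so its fate is a function of u. Where it is kept, the full density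
  r exp(-r) reaches the event of exactly one point, and no larger configuration can lower it again.
  Deleting all single points is impossible only while q 0 is below p 0 + p 1, that is, for s above
  about 0.584; hence a smaller intensity has to be chosen from the window between 0.584 and 0.626.
  In the positive direction everything is tested on void probabilities, because these alone identify
  a Poisson process. This spares any treatment of joint laws of the remaining points.\<close>

lemma sets_unit_borel_iff [simp]: "A \<in> sets unit_borel \<longleftrightarrow> A \<in> sets borel \<and> A \<subseteq> {0..1}"
  by (auto simp: sets_restrict_space_iff)

lemma space_unit_borel: "space unit_borel = {0..1}"
  by (simp add: space_restrict_space)

text \<open>This is counting measure on \<open>S\<close>, pushed forward because
  \<open>count_space S\<close> carries neither the space [0,1] nor its Borel sets.\<close>

definition config :: "real set \<Rightarrow> real measure" where
  "config S = distr (count_space S) unit_borel (\<lambda>x. x)"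

lemma sets_config [simp]: "sets (config S) = sets unit_borel"
  by (simp add: config_def)

lemma emeasure_config:
  assumes "finite S" "S \<subseteq> {0..1}" "A \<in> sets unit_borel"
  shows "emeasure (config S) A = of_nat (card (S \<inter> A))"
proof -
  have "(\<lambda>x. x) \<in> measurable (count_space S) unit_borel"
    using assms by (auto simp: space_unit_borel)
  then show ?thesis
    using assms by (simp add: config_def emeasure_distr emeasure_count_space Int_commute)
qed

lemma config_in_simple_point_measures:
  assumes "finite S" "S \<subseteq> {0..1}"
  shows "config S \<in> simple_point_measures"
proof -
  have "emeasure (config S) {x} \<le> 1" if "x \<in> {0..1}" for x
  proof -
    have "card (S \<inter> {x}) \<le> card {x}" by (intro card_mono) auto
    then show ?thesis
      using that by (subst emeasure_config[OF assms]) (auto simp: Int_insert_right)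
  qed
  then show ?thesis
    using assms by (auto simp: simple_point_measures_def emeasure_config)
qed

lemma emeasure_config_eq_0_iff:
  assumes "finite S" "S \<subseteq> {0..1}" "A \<in> sets unit_borel"
  shows "emeasure (config S) A = 0 \<longleftrightarrow> S \<inter> A = {}"
  using assms by (simp add: emeasure_config)

lemma points_config:
  assumes "finite S" "S \<subseteq> {0..1}"
  shows "points (config S) = S"
proof -
  have "emeasure (config S) {x} \<noteq> 0 \<longleftrightarrow> x \<in> S" if "x \<in> {0..1}" for x
    using that by (subst emeasure_config_eq_0_iff[OF assms]) auto
  then have "points (config S) = {x\<in>{0..1}. x \<in> S}"
    unfolding points_def by (intro Collect_cong) blast
  then show ?thesis
    using assms by blast
qed

subsection \<open>Order statistics\<close>

text \<open>The second disjunct makes the infimum range over all of [0,1] if there are at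
  most i points.\<close>
definition order_stat :: "real measure \<Rightarrow> nat \<Rightarrow> real" where
  "order_stat \<nu> i =
     Inf {t\<in>{0..1}. real (Suc i) \<le> measure \<nu> {0..t} \<or> measure \<nu> {0..1} < real (Suc i)}"

definition num_points :: "real measure \<Rightarrow> nat" where
  "num_points \<nu> = nat \<lfloor>measure \<nu> {0..1}\<rfloor>"

context
  fixes \<nu> assumes \<nu>: "\<nu> \<in> simple_point_measures"
begin

lemma spm_sets: "sets \<nu> = sets unit_borel"
  using \<nu> by (simp add: simple_point_measures_def)

lemma spm_space: "space \<nu> = {0..1}"
  using sets_eq_imp_space_eq[OF spm_sets] by (simp add: space_unit_borel)

lemma spm_emeasure: "A \<in> sets unit_borel \<Longrightarrow> \<exists>n. emeasure \<nu> A = of_nat n"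
  using \<nu> by (simp add: simple_point_measures_def)

lemma spm_finite: "finite_measure \<nu>"
proof
  show "emeasure \<nu> (space \<nu>) \<noteq> \<infinity>"
    using spm_emeasure[of "{0..1}"] by (auto simp: spm_space)
qed

lemma spm_measure: "A \<in> sets unit_borel \<Longrightarrow> \<exists>n. measure \<nu> A = real n"
  using spm_emeasure[of A] by (auto simp: measure_def enn2real_of_nat)

lemma spm_emeasure_eq: "emeasure \<nu> A = ennreal (measure \<nu> A)"
  by (rule finite_measure.emeasure_eq_measure[OF spm_finite])

lemma spm_measure_singleton:
  assumes "x \<in> {0..1}" shows "measure \<nu> {x} \<le> 1"
proof -
  have "emeasure \<nu> {x} \<le> 1"
    using assms \<nu> by (simp add: simple_point_measures_def)
  then show ?thesis
    by (simp add: spm_emeasure_eq)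
qed

lemma measure_num_points: "measure \<nu> {0..1} = real (num_points \<nu>)"
  using spm_measure[of "{0..1}"] by (auto simp: num_points_def)

text \<open>The usual duality between quantiles and distribution functions. The condition on
  \<open>t\<close> is preserved when \<open>t\<close> increases, and right-continuity makes it hold
  at the infimum itself.\<close>

lemma order_stat_le_iff:
  assumes t: "t \<in> {0..1}"
  shows "order_stat \<nu> i \<le> t \<longleftrightarrow>
    real (Suc i) \<le> measure \<nu> {0..t} \<or> measure \<nu> {0..1} < real (Suc i)"
    (is "_ \<longleftrightarrow> ?Q t")
    and "order_stat \<nu> i \<in> {0..1}"
proof -
  interpret finite_measure \<nu> by (rule spm_finite)
  define X where "X = {t\<in>{0..1}. ?Q t}"
  have os: "order_stat \<nu> i = Inf X" by (simp add: order_stat_def X_def)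
  have X1: "1 \<in> X" by (auto simp: X_def)
  have bdd: "bdd_below X" by (auto simp: X_def intro: bdd_belowI[of _ 0])
  have lo: "0 \<le> Inf X" using X1 by (intro cInf_greatest) (auto simp: X_def)
  have hi: "Inf X \<le> 1" using X1 bdd by (intro cInf_lower) auto
  show "order_stat \<nu> i \<in> {0..1}" using lo hi os by simp
  have mono: "?Q v" if "?Q u" "u \<le> v" "v \<le> 1" for u v
  proof -
    have "measure \<nu> {0..u} \<le> measure \<nu> {0..v}"
      using that by (intro finite_measure_mono) (auto simp: spm_sets)
    then show ?thesis using that by linarith
  qed
  have att: "?Q (Inf X)"
  proof (rule ccontr)
    assume n: "\<not> ?Q (Inf X)"
    \<comment> \<open>These intervals decrease to \<open>{0..Inf X}\<close>. The cut at 1 keeps them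
      inside the space; an interval that is cut equals \<open>{0..1}\<close>, which has enough mass
      because the second disjunct of \<open>?Q\<close> is assumed to fail.\<close>
    define A where "A k = {0..min 1 (Inf X + 1 / real (Suc k))}" for k
    have "A k \<in> sets \<nu>" for k by (auto simp: spm_sets A_def)
    moreover have "decseq A"
      unfolding A_def by (intro decseq_SucI) (auto simp: field_simps min_le_iff_disj)
    moreover have "(\<Inter>k. A k) = {0..Inf X}"
    proof -
      have "x \<le> Inf X" if "\<forall>k. x \<le> Inf X + 1 / real (Suc k)" for x
      proof (rule field_le_epsilon)
        fix e :: real assume "0 < e"
        then obtain k where "1 / real (Suc k) < e" using nat_approx_posE by blast
        then show "x \<le> Inf X + e" using that[rule_format, of k] by linarith
      qed
      moreover have "{0..Inf X} \<subseteq> A k" for k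
      proof -
        have "0 < 1 / real (Suc k)" by simp
        then show ?thesis using hi by (auto simp: A_def simp del: of_nat_Suc)
      qed
      ultimately show ?thesis
        by (intro equalityI INT_greatest) (auto simp: A_def simp del: of_nat_Suc)
    qed
    ultimately have "(\<lambda>k. measure \<nu> (A k)) \<longlonglongrightarrow> measure \<nu> {0..Inf X}"
      using finite_Lim_measure_decseq[of A] by auto
    moreover have "real (Suc i) \<le> measure \<nu> (A k)" for k
    proof (cases "Inf X + 1 / real (Suc k) \<le> 1")
      case True
      have "Inf X < Inf X + 1 / real (Suc k)" by simp
      then obtain u where "u \<in> X" "u < Inf X + 1 / real (Suc k)"
        using X1 bdd by (subst (asm) cInf_less_iff) auto
      moreover from \<open>u \<in> X\<close> have "?Q u" unfolding X_def by blast
      ultimately have "?Q (Inf X + 1 / real (Suc k))"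
        using True mono less_imp_le by blast
      with n have "real (Suc i) \<le> measure \<nu> {0..Inf X + 1 / real (Suc k)}" by blast
      then show ?thesis unfolding A_def min_absorb2[OF True] .
    next
      case False
      then have "A k = {0..1}" by (simp add: A_def del: of_nat_Suc)
      then show ?thesis using n by (simp del: of_nat_Suc)
    qed
    ultimately have "real (Suc i) \<le> measure \<nu> {0..Inf X}"
      by (intro LIMSEQ_le_const) auto
    with n show False by simp
  qed
  show "order_stat \<nu> i \<le> t \<longleftrightarrow> ?Q t"
  proof
    assume "order_stat \<nu> i \<le> t"
    then show "?Q t" using mono[OF att] t os by simp
  next
    assume "?Q t"
    then show "order_stat \<nu> i \<le> t"
      unfolding os using t bdd by (intro cInf_lower) (auto simp: X_def)
  qed
qed

text \<open>This is where simplicity enters. If the order statistics \<open>i < j\<close> met at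
  \<open>x\<close>, the distribution function would jump there from at most \<open>i\<close> to at
  least \<open>j + 1\<close>, hence by at least 2.\<close>

lemma inj_on_order_stat: "inj_on (order_stat \<nu>) {..<num_points \<nu>}"
proof -
  interpret finite_measure \<nu> by (rule spm_finite)
  have False if ij: "i < j" "j < num_points \<nu>" "order_stat \<nu> i = order_stat \<nu> j" for i j
  proof -
    define x where "x = order_stat \<nu> i"
    have x: "x \<in> {0..1}" unfolding x_def by (rule order_stat_le_iff(2)[of 0]) simp
    have low: "measure \<nu> {0..t} < real (Suc i)" if "t < x" "0 \<le> t" for t
      using order_stat_le_iff(1)[of t i] that x ij measure_num_points by (auto simp: x_def)
    have "measure \<nu> {0..<x} \<le> real i"
    proof -
      \<comment> \<open>Subtracting a fraction of \<open>x\<close>, not a constant, keeps the right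
        end points nonnegative.\<close>
      define A where "A k = {0..x - x / real (Suc k)}" for k
      have nn: "0 \<le> x / real (Suc k)" "x / real (Suc k) \<le> x" for k 
        using x by (auto simp: field_simps)
      have "A k \<in> sets \<nu>" for k
        using x nn[of k] by (auto simp: spm_sets A_def)
      moreover have "incseq A"
        unfolding A_def using x by (intro incseq_SucI) (auto simp: intro!: order_trans[OF _ diff_left_mono] divide_left_mono)
      moreover have "(\<Union>k. A k) = {0..<x}" if "x > 0"
      proof -
        have "\<exists>k. y \<le> x - x / real (Suc k)" if "0 \<le> y" "y < x" for y
        proof -
          have "0 < (x - y) / x" using that \<open>x > 0\<close> by simp
          then obtain k where "1 / real (Suc k) < (x - y) / x"
            by (rule nat_approx_posE)
          then have "x / real (Suc k) < x - y"
            using \<open>x > 0\<close> by (simp add: field_simps)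
          then show ?thesis by (intro exI[of _ k]) linarith
        qed
        then show ?thesis
        proof (intro equalityI subsetI)
          fix y assume "y \<in> (\<Union>k. A k)"
          then obtain k where "0 \<le> y" "y \<le> x - x / real (Suc k)" by (auto simp: A_def)
          moreover have "x / real (Suc k) > 0" using \<open>x > 0\<close> by simp
          ultimately show "y \<in> {0..<x}" by simp
        qed (auto simp: A_def)
      qed
      ultimately have lim: "(\<lambda>k. measure \<nu> (A k)) \<longlonglongrightarrow> measure \<nu> {0..<x}" if "x > 0"
        using finite_Lim_measure_incseq[of A] that by auto
      \<comment> \<open>Masses are integers, so staying below \<open>Suc i\<close> improves to at
        most \<open>i\<close>, a bound that survives the limit.\<close>
      have "measure \<nu> (A k) \<le> real i" if "x > 0" for k
      proof -
        have "x / real (Suc k) > 0" using that by simp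
        then have "measure \<nu> (A k) < real (Suc i)"
          using nn[of k] that by (auto simp: A_def simp del: of_nat_Suc intro!: low)
        moreover obtain m where "measure \<nu> (A k) = real m"
          using spm_measure[of "A k"] \<open>\<And>k. A k \<in> sets \<nu>\<close> spm_sets by metis
        ultimately show ?thesis by simp
      qed
      then show ?thesis using lim x
        by (cases "x > 0") (auto intro: LIMSEQ_le_const2)
    qed
    moreover have "measure \<nu> {0..x} = measure \<nu> {0..<x} + measure \<nu> {x}"
    proof -
      have "{0..x} = {0..<x} \<union> {x}" using x by auto
      then show ?thesis
        using x by (simp only:) (rule finite_measure_Union, auto simp: spm_sets)
    qed
    moreover have "measure \<nu> {0..x} \<ge> real (Suc j)"
      using order_stat_le_iff(1)[of x j] x ij measure_num_points by (auto simp: x_def)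
    moreover have "measure \<nu> {x} \<le> 1" by (rule spm_measure_singleton[OF x])
    ultimately show False using ij by linarith
  qed
  then show ?thesis
    by (metis (no_types, lifting) inj_onI lessThan_iff linorder_neqE_nat)
qed

text \<open>Both measures have the same distribution function: if \<open>{0..t}\<close> has mass
  \<open>m\<close>, the atoms in it are exactly the first \<open>m\<close> order statistics, and
  these are distinct.\<close>

lemma spm_eq_config: "\<nu> = config (order_stat \<nu> ` {..<num_points \<nu>})"
proof -
  interpret finite_measure \<nu> by (rule spm_finite)
  define S where "S = order_stat \<nu> ` {..<num_points \<nu>}"
  have S: "finite S" "S \<subseteq> {0..1}"
    using order_stat_le_iff(2)[of 0] by (auto simp: S_def)
  have cdf: "emeasure \<nu> {0..t} = emeasure (config S) {0..t}" if t: "t \<in> {0..1}" for t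
  proof -
    obtain m where m: "measure \<nu> {0..t} = real m"
      using spm_measure[of "{0..t}"] t by auto
    have "measure \<nu> {0..t} \<le> measure \<nu> {0..1}"
      using t by (intro finite_measure_mono) (auto simp: spm_sets)
    then have mn: "m \<le> num_points \<nu>" using m measure_num_points by simp
    have "S \<inter> {0..t} = order_stat \<nu> ` {..<m}"
      using order_stat_le_iff[OF t] m mn measure_num_points S by (force simp: S_def)
    moreover have "card (order_stat \<nu> ` {..<m}) = m"
      using mn by (subst card_image) (auto intro: inj_on_subset[OF inj_on_order_stat])
    ultimately show ?thesis
      using S t m by (subst emeasure_config) (auto simp: spm_emeasure_eq ennreal_of_nat_eq_real_of_nat)
  qed
  \<comment> \<open>Transport to the whole real line, where the half-lines are an
    intersection-stable generator of the Borel sets.\<close>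
  have d: "emeasure (distr \<mu> borel (\<lambda>x. x)) B = emeasure \<mu> (B \<inter> {0..1})"
    if "sets \<mu> = sets unit_borel" "B \<in> sets borel" for \<mu> and B :: "real set"
  proof -
    have "space \<mu> = {0..1}" using sets_eq_imp_space_eq[OF that(1)] by (simp add: space_unit_borel)
    moreover have "(\<lambda>x. x) \<in> measurable \<mu> borel"
      unfolding measurable_cong_sets[OF that(1) refl] by (rule measurable_restrict_space1) simp
    ultimately show ?thesis using that(2) by (simp add: emeasure_distr)
  qed
  have "distr \<nu> borel (\<lambda>x. x) = distr (config S) borel (\<lambda>x. x)"
  proof (rule measure_eqI_generator_eq[where E = "range atMost" and \<Omega> = UNIV and A = "\<lambda>i. {..real i}"])
    show "Int_stable (range (atMost :: real \<Rightarrow> _))" by (auto simp: Int_stable_def)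
    show "(\<Union>i. {..real i}) = UNIV" using real_arch_simple by auto
    show "emeasure (distr \<nu> borel (\<lambda>x. x)) X = emeasure (distr (config S) borel (\<lambda>x. x)) X"
      if "X \<in> range atMost" for X
    proof -
      from that obtain a where X: "X = {..a}" by auto
      have "{..a} \<inter> {0..1} = {} \<or> min a 1 \<in> {0..1} \<and> {..a} \<inter> {0..1} = {0..min a 1}"
        by auto
      then have "emeasure \<nu> ({..a} \<inter> {0..1}) = emeasure (config S) ({..a} \<inter> {0..1})"
        using cdf[of "min a 1"] by (elim disjE conjE) (simp_all only: emeasure_empty)
      then show ?thesis
        using d[OF spm_sets, of X] d[OF sets_config, of X S] X by simp
    qed
    show "emeasure (distr \<nu> borel (\<lambda>x. x)) {..real i} \<noteq> \<infinity>" for i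
      by (subst d[OF spm_sets]) (auto simp: spm_emeasure_eq)
  qed (auto simp: borel_eq_atMost)
  then have "emeasure \<nu> A = emeasure (config S) A" if "A \<in> sets \<nu>" for A
    using d[OF spm_sets, of A] d[OF sets_config, of A S] that
    by (simp add: spm_sets Int_absorb2)
  then show ?thesis
    unfolding S_def[symmetric] by (intro measure_eqI) (auto simp: spm_sets)
qed

lemma points_eq_order_stat: "points \<nu> = order_stat \<nu> ` {..<num_points \<nu>}"
proof -
  have "points (config (order_stat \<nu> ` {..<num_points \<nu>})) = order_stat \<nu> ` {..<num_points \<nu>}"
    using order_stat_le_iff(2)[of 0] by (intro points_config) auto
  then show ?thesis using spm_eq_config by simp
qed

lemma finite_points: "finite (points \<nu>)"
  by (simp add: points_eq_order_stat)

lemma config_points: "config (points \<nu>) = \<nu>"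
  using spm_eq_config by (simp add: points_eq_order_stat)

end

lemma points_subset: "points \<nu> \<subseteq> {0..1}"
  by (auto simp: points_def)

subsection \<open>Void events\<close>

text \<open>Two points at distance at least \<open>1 / 2 ^ k\<close> cannot share a dyadic cell of
  level \<open>k\<close>. This serves twice: to count points by counting cells, and to make
  \<open>dyadic_level\<close> well defined.\<close>

lemma eventually_inj_on_dyadic:
  fixes S :: "real set"
  assumes "finite S"
  shows "eventually (\<lambda>k. inj_on (\<lambda>x. \<lfloor>2 ^ k * x\<rfloor>) S) sequentially"
proof -
  have "eventually (\<lambda>k. \<lfloor>2 ^ k * x\<rfloor> \<noteq> \<lfloor>2 ^ k * y\<rfloor>) sequentially" if "x \<noteq> y" for x y :: real
  proof -
    have "filterlim (\<lambda>k. 2 ^ k * \<bar>x - y\<bar>) at_top sequentially"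
      using that by real_asymp
    then have "eventually (\<lambda>k. 1 \<le> 2 ^ k * \<bar>x - y\<bar>) sequentially"
      by (simp add: filterlim_at_top)
    then show ?thesis
    proof eventually_elim
      case (elim k)
      then have "1 \<le> \<bar>2 ^ k * x - 2 ^ k * y\<bar>"
        by (simp add: abs_mult flip: right_diff_distrib)
      then show ?case by linarith
    qed
  qed
  then have "eventually (\<lambda>k. \<forall>x\<in>S. \<forall>y\<in>S. x \<noteq> y \<longrightarrow> \<lfloor>2 ^ k * x\<rfloor> \<noteq> \<lfloor>2 ^ k * y\<rfloor>) sequentially"
    using assms by (intro eventually_ball_finite ballI) auto
  then show ?thesis
    by eventually_elim (auto simp: inj_on_def)
qed

text \<open>The parameter \<open>A\<close> localises the events: those for \<open>A\<close> generate
  the information carried by the restriction of the measure to \<open>A\<close>. Independence over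
  disjoint sets needs this, whereas \<open>{0..1}\<close> yields the whole sigma-algebra.\<close>

definition void_events :: "real set \<Rightarrow> real measure set set" where
  "void_events A =
     {{\<nu> \<in> simple_point_measures. emeasure \<nu> B = 0} | B. B \<in> sets unit_borel \<and> B \<subseteq> A}"

lemma void_events_subset: "void_events A \<subseteq> Pow simple_point_measures"
  by (auto simp: void_events_def)

lemma void_eventsI:
  "B \<in> sets unit_borel \<Longrightarrow> B \<subseteq> A \<Longrightarrow> {\<nu> \<in> simple_point_measures. emeasure \<nu> B = 0} \<in> void_events A"
  unfolding void_events_def by blast

lemma emeasure_eq_0_iff_points:
  assumes "\<nu> \<in> simple_point_measures" "A \<in> sets unit_borel"
  shows "emeasure \<nu> A = 0 \<longleftrightarrow> points \<nu> \<inter> A = {}"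
  using emeasure_config_eq_0_iff[OF finite_points[OF assms(1)] points_subset assms(2)]
  by (simp add: config_points[OF assms(1)])

lemma emeasure_eq_card_points:
  assumes "\<nu> \<in> simple_point_measures" "A \<in> sets unit_borel"
  shows "emeasure \<nu> A = of_nat (card (points \<nu> \<inter> A))"
  using emeasure_config[OF finite_points[OF assms(1)] points_subset assms(2)]
  by (simp add: config_points[OF assms(1)])

text \<open>Counts are limits of the numbers of nonempty dyadic cells.\<close>
lemma measurable_count_void:
  assumes A: "A \<in> sets unit_borel"
  shows "(\<lambda>\<nu>. emeasure \<nu> A) \<in> borel_measurable (sigma simple_point_measures (void_events A))"
proof -
  let ?V = "sigma simple_point_measures (void_events A)"
  have space: "space ?V = simple_point_measures"
    by (rule space_measure_of[OF void_events_subset])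
  define C where "C k j = A \<inter> {x. \<lfloor>2 ^ k * x\<rfloor> = j}" for k and j :: int
  have C: "C k j \<in> sets unit_borel" for k j
  proof -
    have "{x \<in> space borel. \<lfloor>2 ^ k * x\<rfloor> = j} \<in> sets (borel :: real measure)"
      by measurable
    then show ?thesis using A by (auto simp: C_def)
  qed
  \<comment> \<open>The last index \<open>2 ^ k\<close> accounts for the point 1, which is alone in
    its cell.\<close>
  define u :: "nat \<Rightarrow> real measure \<Rightarrow> ennreal" where
    "u k \<nu> = (\<Sum>j=0..2 ^ k. if emeasure \<nu> (C k j) = 0 then 0 else 1)" for k \<nu>
  have "Measurable.pred ?V (\<lambda>\<nu>. emeasure \<nu> (C k j) = 0)" for k j
  proof -
    have "{\<nu> \<in> simple_point_measures. emeasure \<nu> (C k j) = 0} \<in> void_events A"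
      using C by (rule void_eventsI) (auto simp: C_def)
    then show ?thesis
      unfolding pred_def space by (simp add: sets_measure_of[OF void_events_subset])
  qed
  then have u: "u k \<in> borel_measurable ?V" for k
    unfolding u_def by measurable
  have "(\<lambda>k. u k \<nu>) \<longlonglongrightarrow> emeasure \<nu> A" if \<nu>: "\<nu> \<in> simple_point_measures" for \<nu>
  proof (rule tendsto_eventually)
    define S where "S = points \<nu>"
    have S: "finite S" "S \<subseteq> {0..1}"
      using finite_points[OF \<nu>] points_subset by (auto simp: S_def)
    have "finite (S \<inter> A)" using S by simp
    then have "eventually (\<lambda>k. inj_on (\<lambda>x. \<lfloor>2 ^ k * x\<rfloor>) (S \<inter> A)) sequentially"
      by (rule eventually_inj_on_dyadic)
    then show "eventually (\<lambda>k. u k \<nu> = emeasure \<nu> A) sequentially"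
    proof eventually_elim
      case (elim k)
      let ?J = "(\<lambda>x. \<lfloor>2 ^ k * x\<rfloor>) ` (S \<inter> A)"
      have "?J \<subseteq> {0..2 ^ k}"
      proof
        fix j assume "j \<in> ?J"
        then obtain x where "x \<in> S" "j = \<lfloor>2 ^ k * x\<rfloor>" by auto
        with S have x: "0 \<le> x" "x \<le> 1" "j = \<lfloor>2 ^ k * x\<rfloor>" by auto
        then have "2 ^ k * x \<le> 2 ^ k" by simp
        then have "\<lfloor>2 ^ k * x\<rfloor> \<le> \<lfloor>2 ^ k :: real\<rfloor>" by (rule floor_mono)
        then show "j \<in> {0..2 ^ k}" using x by simp
      qed
      moreover have "emeasure \<nu> (C k j) = 0 \<longleftrightarrow> S \<inter> C k j = {}" for j
        using emeasure_eq_0_iff_points[OF \<nu> C] by (simp add: S_def)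
      ultimately have J: "{j \<in> {0..2 ^ k}. emeasure \<nu> (C k j) \<noteq> 0} = ?J"
        by (auto simp: C_def)
      have "u k \<nu> = (\<Sum>j\<in>{j \<in> {0..2 ^ k}. emeasure \<nu> (C k j) \<noteq> 0}. 1)"
        unfolding u_def by (rule sum.mono_neutral_cong_right) auto
      also have "\<dots> = of_nat (card ?J)"
        unfolding J by simp
      also have "card ?J = card (S \<inter> A)"
        using elim by (rule card_image)
      finally show ?case
        using emeasure_eq_card_points[OF \<nu> A] by (simp add: S_def)
    qed
  qed
  then have "(\<lambda>k. u k \<nu>) \<longlonglongrightarrow> emeasure \<nu> A" if "\<nu> \<in> space ?V" for \<nu>
    using that unfolding space .
  then show ?thesis
    by (rule borel_measurable_LIMSEQ_order[OF _ u])
qed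

text \<open>Counts are measurable with respect to void events by
  \<open>measurable_count_void\<close>. From here on, measurability into \<open>point_space\<close>
  and equality of laws are checked on void events only.\<close>

lemma sets_point_space: "sets point_space = sigma_sets simple_point_measures (void_events {0..1})"
proof
  have "void_events {0..1} \<subseteq> sets point_space"
  proof
    fix V assume "V \<in> void_events {0..1}"
    then obtain B where B: "B \<in> sets unit_borel" "V = {\<nu> \<in> simple_point_measures. emeasure \<nu> B = 0}"
      by (auto simp: void_events_def)
    have "(\<lambda>\<nu>. emeasure \<nu> B) -` {0} \<inter> space point_space \<in> sets point_space"
      by (rule measurable_sets[OF measurable_count[OF B(1)]]) simp
    also have "(\<lambda>\<nu>. emeasure \<nu> B) -` {0} \<inter> space point_space = V"
      by (auto simp: B space_point_space)
    finally show "V \<in> sets point_space" .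
  qed
  then show "sigma_sets simple_point_measures (void_events {0..1}) \<subseteq> sets point_space"
    by (subst space_point_space[symmetric]) (rule sets.sigma_sets_subset)
next
  let ?V = "sigma simple_point_measures (void_events {0..1})"
  have "{\<nu> \<in> simple_point_measures. emeasure \<nu> A \<in> B} \<in> sets ?V"
    if A: "A \<in> sets unit_borel" and B: "B \<in> sets borel" for A B
  proof -
    have "sigma_sets simple_point_measures (void_events A) \<subseteq> sigma_sets simple_point_measures (void_events {0..1})"
      using A by (intro sigma_sets_mono') (auto simp: void_events_def)
    moreover have "(\<lambda>\<nu>. emeasure \<nu> A) -` B \<inter> simple_point_measures
        \<in> sigma_sets simple_point_measures (void_events A)"
      using measurable_sets[OF measurable_count_void[OF A] B]
      by (simp add: space_measure_of sets_measure_of void_events_subset)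
    ultimately show ?thesis
      by (auto simp: sets_measure_of void_events_subset vimage_def Int_def conj_commute)
  qed
  then have "sigma_sets simple_point_measures
      {{\<nu> \<in> simple_point_measures. emeasure \<nu> A \<in> B} | A B. A \<in> sets unit_borel \<and> B \<in> sets borel} \<subseteq> sets ?V"
    by (intro sets.sigma_sets_subset[of _ ?V, simplified space_measure_of[OF void_events_subset]]) blast
  then show "sets point_space \<subseteq> sigma_sets simple_point_measures (void_events {0..1})"
    unfolding point_space_def sets_measure_of[OF void_events_subset]
    by (subst sets_measure_of) auto
qed

lemma measurable_point_spaceI:
  assumes "\<And>\<omega>. \<omega> \<in> space M \<Longrightarrow> g \<omega> \<in> simple_point_measures"
    and "\<And>A. A \<in> sets unit_borel \<Longrightarrow> {\<omega>\<in>space M. emeasure (g \<omega>) A = 0} \<in> sets M"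
  shows "g \<in> measurable M point_space"
proof -
  have "g \<in> measurable M (sigma simple_point_measures (void_events {0..1}))"
  proof (rule measurable_measure_of[OF void_events_subset])
    show "g \<in> space M \<rightarrow> simple_point_measures" using assms(1) by auto
    fix V assume "V \<in> void_events {0..1}"
    then obtain B where B: "B \<in> sets unit_borel" "V = {\<nu> \<in> simple_point_measures. emeasure \<nu> B = 0}"
      by (auto simp: void_events_def)
    have "g -` V \<inter> space M = {\<omega>\<in>space M. emeasure (g \<omega>) B = 0}"
      using assms(1) by (auto simp: B)
    then show "g -` V \<inter> space M \<in> sets M" using assms(2)[OF B(1)] by simp
  qed
  also have "measurable M (sigma simple_point_measures (void_events {0..1})) = measurable M point_space"
    by (intro measurable_cong_sets) (simp_all add: sets_point_space sets_measure_of void_events_subset)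
  finally show ?thesis .
qed

text \<open>Missing \<open>B\<close> and missing \<open>C\<close> is the same as missing their
  union.\<close>

lemma Int_stable_void_events: "Int_stable (void_events A)"
proof (rule Int_stableI)
  fix V W assume "V \<in> void_events A" "W \<in> void_events A"
  then obtain B C where BC: "B \<in> sets unit_borel" "B \<subseteq> A" "V = {\<nu> \<in> simple_point_measures. emeasure \<nu> B = 0}"
     "C \<in> sets unit_borel" "C \<subseteq> A" "W = {\<nu> \<in> simple_point_measures. emeasure \<nu> C = 0}"
    by (auto simp: void_events_def)
  then have "B \<union> C \<in> sets unit_borel" by blast
  moreover from this have "V \<inter> W = {\<nu> \<in> simple_point_measures. emeasure \<nu> (B \<union> C) = 0}"
    using BC by (auto simp: emeasure_eq_0_iff_points simp del: sets_unit_borel_iff)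
  moreover have "B \<union> C \<subseteq> A" using BC by blast
  ultimately show "V \<inter> W \<in> void_events A"
    using void_eventsI by presburger
qed

text \<open>Renyi's theorem.\<close>
lemma point_law_eqI:
  assumes M: "prob_space M" "sets M = sets point_space" and N: "prob_space N" "sets N = sets point_space"
    and eq: "\<And>A. A \<in> sets unit_borel \<Longrightarrow>
      emeasure M {\<nu> \<in> simple_point_measures. emeasure \<nu> A = 0} =
      emeasure N {\<nu> \<in> simple_point_measures. emeasure \<nu> A = 0}"
  shows "M = N"
proof (rule measure_eqI_generator_eq[OF Int_stable_void_events void_events_subset])
  interpret M: prob_space M by fact
  show "sets M = sigma_sets simple_point_measures (void_events {0..1})"
    using M(2) unfolding sets_point_space .
  show "sets N = sigma_sets simple_point_measures (void_events {0..1})"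
    using N(2) unfolding sets_point_space .
  show "range (\<lambda>_::nat. simple_point_measures) \<subseteq> void_events {0..1}"
    using void_eventsI[of "{}" "{0..1}"] by auto
  show "emeasure M simple_point_measures \<noteq> \<infinity>" by simp
  fix X assume "X \<in> void_events {0..1}"
  then show "emeasure M X = emeasure N X"
    unfolding void_events_def using eq by blast
qed simp

subsection \<open>The Poisson law\<close>

abbreviation unit_lborel :: "real measure" where
  "unit_lborel \<equiv> restrict_space lborel {0..1}"

abbreviation iid_uniform :: "'i set \<Rightarrow> ('i \<Rightarrow> real) measure" where
  "iid_uniform I \<equiv> Pi\<^sub>M I (\<lambda>_. unit_lborel)"

lemma sets_unit_lborel: "sets unit_lborel = sets unit_borel"
  by (simp add: sets_restrict_space)

lemma space_unit_lborel: "space unit_lborel = {0..1}"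
  by (simp add: space_restrict_space)

lemma emeasure_unit_lborel: "A \<in> sets unit_borel \<Longrightarrow> emeasure unit_lborel A = emeasure lborel A"
  by (subst emeasure_restrict_space) auto

lemma measure_unit_lborel: "A \<in> sets unit_borel \<Longrightarrow> measure unit_lborel A = measure lborel A"
  by (simp add: measure_def emeasure_unit_lborel del: sets_unit_borel_iff)

lemma prob_space_unit_lborel: "prob_space unit_lborel"
  by (rule prob_spaceI) (simp add: space_unit_lborel emeasure_unit_lborel)

interpretation unif: prob_space unit_lborel
  by (rule prob_space_unit_lborel)

interpretation iid: product_prob_space "\<lambda>_. unit_lborel" I for I
  by standard

lemma measure_lborel_unit:
  assumes "A \<in> sets unit_borel"
  shows "measure lborel A \<le> 1" "measure lborel ({0..1} - A) = 1 - measure lborel A"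
    and "emeasure lborel A = ennreal (measure lborel A)"
proof -
  show "measure lborel A \<le> 1"
    using unif.prob_le_1[of A] measure_unit_lborel[OF assms] by simp
  have "{0..1} - A \<in> sets unit_borel" using assms by auto
  then show "measure lborel ({0..1} - A) = 1 - measure lborel A"
    using unif.prob_compl[of A] measure_unit_lborel[of "{0..1} - A"] measure_unit_lborel[OF assms] assms
    by (simp add: space_unit_lborel sets_unit_lborel)
  show "emeasure lborel A = ennreal (measure lborel A)"
    using unif.emeasure_eq_measure[of A] assms
    by (simp add: emeasure_unit_lborel measure_unit_lborel del: sets_unit_borel_iff)
qed

lemma prob_space_iid: "prob_space (iid_uniform I)"
  by (intro prob_space_PiM prob_space_unit_lborel)

lemma image_iid: "x \<in> space (iid_uniform I) \<Longrightarrow> x ` I \<subseteq> {0..1}"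
  by (auto simp: space_PiM space_unit_lborel PiE_iff)

lemma measurable_iid_component:
  assumes "i \<in> I"
  shows "(\<lambda>x. x i) \<in> borel_measurable (iid_uniform I)"
proof -
  have "(\<lambda>x. x i) \<in> measurable (iid_uniform I) unit_lborel"
    using assms by (rule measurable_component_singleton)
  also have "\<dots> = measurable (iid_uniform I) unit_borel"
    by (intro measurable_cong_sets sets_unit_lborel refl)
  finally show ?thesis
    by (simp add: measurable_restrict_space2_iff)
qed

lemma config_image_void_iff:
  assumes "finite I" "x \<in> space (iid_uniform I)" "A \<in> sets unit_borel"
  shows "emeasure (config (x ` I)) A = 0 \<longleftrightarrow> (\<forall>i\<in>I. x i \<notin> A)"
  using assms image_iid[OF assms(2)] by (subst emeasure_config_eq_0_iff) auto

lemma measurable_config_image: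
  assumes "finite I"
  shows "(\<lambda>x. config (x ` I)) \<in> measurable (iid_uniform I) point_space"
proof (rule measurable_point_spaceI)
  fix x assume "x \<in> space (iid_uniform I)"
  then show "config (x ` I) \<in> simple_point_measures"
    using assms image_iid by (intro config_in_simple_point_measures) auto
next
  fix A assume A: "A \<in> sets unit_borel"
  then have [measurable]: "A \<in> sets borel" by simp
  have "{x \<in> space (iid_uniform I). \<forall>i\<in>I. x i \<notin> A} \<in> sets (iid_uniform I)"
  proof (intro sets.sets_Collect_finite_All assms)
    fix i assume "i \<in> I"
    then have [measurable]: "(\<lambda>x. x i) \<in> borel_measurable (iid_uniform I)"
      by (rule measurable_iid_component)
    show "{x \<in> space (iid_uniform I). x i \<notin> A} \<in> sets (iid_uniform I)"
      by measurable
  qed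
  also have "{x \<in> space (iid_uniform I). \<forall>i\<in>I. x i \<notin> A} =
      {x \<in> space (iid_uniform I). emeasure (config (x ` I)) A = 0}"
    using config_image_void_iff[OF assms _ A] by blast
  finally show "{x \<in> space (iid_uniform I). emeasure (config (x ` I)) A = 0} \<in> sets (iid_uniform I)" .
qed

lemma measure_iid_box:
  assumes I: "finite I" and B: "\<And>i. i \<in> I \<Longrightarrow> B i \<in> sets unit_borel"
  shows "{x \<in> space (iid_uniform I). \<forall>i\<in>I. x i \<in> B i} \<in> sets (iid_uniform I)"
    and "measure (iid_uniform I) {x \<in> space (iid_uniform I). \<forall>i\<in>I. x i \<in> B i} =
    (\<Prod>i\<in>I. measure lborel (B i))"
proof -
  have box: "{x \<in> space (iid_uniform I). \<forall>i\<in>I. x i \<in> B i} = Pi\<^sub>E I B"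
  proof (rule set_eqI)
    fix x
    have "x i \<in> {0..1}" if "i \<in> I" "x i \<in> B i" for i using B[OF that(1)] that(2) by auto
    then show "x \<in> {x \<in> space (iid_uniform I). \<forall>i\<in>I. x i \<in> B i} \<longleftrightarrow> x \<in> Pi\<^sub>E I B"
      unfolding mem_Collect_eq space_PiM space_unit_lborel PiE_iff by blast
  qed
  show "{x \<in> space (iid_uniform I). \<forall>i\<in>I. x i \<in> B i} \<in> sets (iid_uniform I)"
    unfolding box using I B by (intro sets_PiM_I_finite) (auto simp: sets_unit_lborel)
  have "emeasure (iid_uniform I) (Pi\<^sub>E I B) = (\<Prod>i\<in>I. emeasure unit_lborel (B i))"
    using I B unfolding sets_unit_lborel[symmetric] by (rule iid.emeasure_PiM)
  also have "\<dots> = (\<Prod>i\<in>I. ennreal (measure lborel (B i)))"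
    using B by (intro prod.cong refl) (metis emeasure_unit_lborel measure_lborel_unit(3))
  finally show "measure (iid_uniform I) {x \<in> space (iid_uniform I). \<forall>i\<in>I. x i \<in> B i} =
      (\<Prod>i\<in>I. measure lborel (B i))"
    unfolding box by (simp add: measure_def prod_ennreal prod_nonneg)
qed

text \<open>By Fubini: once all coordinates but \<open>i\<close> are fixed, the uniform coordinate
  \<open>i\<close> hits the given value \<open>x j\<close> with probability 0.\<close>

lemma AE_iid_inj:
  assumes I: "finite I"
  shows "AE x in iid_uniform I. inj_on x I"
proof -
  have *: "AE x in iid_uniform I. x i \<noteq> x j" if ij: "i \<in> I" "j \<in> I" "i \<noteq> j" for i j
  proof -
    define K where "K = I - {i}"
    have K: "finite K" "i \<notin> K" "I = insert i K" "j \<in> K" using I ij by (auto simp: K_def)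
    have [measurable]: "(\<lambda>x. x i) \<in> borel_measurable (iid_uniform I)"
        "(\<lambda>x. x j) \<in> borel_measurable (iid_uniform I)"
      using ij by (auto intro: measurable_iid_component)
    have m: "{x \<in> space (iid_uniform I). x i = x j} \<in> sets (iid_uniform I)"
      by measurable
    then have "emeasure (iid_uniform I) {x \<in> space (iid_uniform I). x i = x j} =
        (\<integral>\<^sup>+x. indicator {x \<in> space (iid_uniform I). x i = x j} x \<partial>iid_uniform (insert i K))"
      using K by simp
    also have "\<dots> = (\<integral>\<^sup>+x. (\<integral>\<^sup>+u. indicator {x \<in> space (iid_uniform I). x i = x j} (x(i := u)) \<partial>unit_lborel)
        \<partial>iid_uniform K)"
      using K m by (intro iid.product_nn_integral_insert) auto
    also have "\<dots> = (\<integral>\<^sup>+x. 0 \<partial>iid_uniform K)"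
    proof (rule nn_integral_cong)
      fix x
      assume "x \<in> space (iid_uniform K)"
      have "AE u in lborel. u \<in> {0..1} \<longrightarrow> u \<noteq> x j"
        using AE_lborel_singleton[of "x j"] by eventually_elim simp
      then have "AE u in unit_lborel. u \<noteq> x j"
        by (subst AE_restrict_space_iff) simp_all
      then have "AE u in unit_lborel.
          (indicator {x \<in> space (iid_uniform I). x i = x j} (x(i := u)) :: ennreal) = 0"
        by eventually_elim (use ij in auto)
      then have "(\<integral>\<^sup>+u. indicator {x \<in> space (iid_uniform I). x i = x j} (x(i := u)) \<partial>unit_lborel) =
          (\<integral>\<^sup>+u. 0 \<partial>unit_lborel)"
        by (rule nn_integral_cong_AE)
      then show "(\<integral>\<^sup>+u. indicator {x \<in> space (iid_uniform I). x i = x j} (x(i := u)) \<partial>unit_lborel) = 0"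
        by simp
    qed
    finally have "emeasure (iid_uniform I) {x \<in> space (iid_uniform I). x i = x j} = 0"
      by simp
    then show ?thesis
      using AE_iff_measurable[OF m, of "\<lambda>x. x i \<noteq> x j"] by simp
  qed
  have "AE x in iid_uniform I. \<forall>i\<in>I. \<forall>j\<in>I. i \<noteq> j \<longrightarrow> x i \<noteq> x j"
  proof (intro AE_finite_allI I)
    show "AE x in iid_uniform I. i \<noteq> j \<longrightarrow> x i \<noteq> x j" if "i \<in> I" "j \<in> I" for i j
      using * that by (cases "i = j") simp_all
  qed
  then show ?thesis
    by eventually_elim (auto simp: inj_on_def)
qed

text \<open>Equal coordinates would merge into one point, but this has probability 0 by
  \<open>AE_iid_inj\<close>. The law is that of a Poisson process conditioned on having
  \<open>n\<close> points.\<close>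

definition config_law :: "nat \<Rightarrow> real measure measure" where
  "config_law n = distr (iid_uniform {..<n}) point_space (\<lambda>x. config (x ` {..<n}))"

lemma prob_space_config_law: "prob_space (config_law n)"
  unfolding config_law_def
  by (intro prob_space.prob_space_distr prob_space_iid measurable_config_image) simp

lemma sets_config_law [simp]: "sets (config_law n) = sets point_space"
  by (simp add: config_law_def)

lemma measure_config_law:
  assumes "{\<nu> \<in> simple_point_measures. P \<nu>} \<in> sets point_space"
  shows "measure (config_law n) {\<nu> \<in> simple_point_measures. P \<nu>} =
    measure (iid_uniform {..<n}) {x \<in> space (iid_uniform {..<n}). P (config (x ` {..<n}))}"
proof -
  have "(\<lambda>x. config (x ` {..<n})) -` {\<nu> \<in> simple_point_measures. P \<nu>} \<inter> space (iid_uniform {..<n}) =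
    {x \<in> space (iid_uniform {..<n}). P (config (x ` {..<n}))}"
    using measurable_space[OF measurable_config_image[of "{..<n}"]] by (auto simp: space_point_space)
  then show ?thesis
    using assms unfolding config_law_def by (subst measure_distr) (auto simp: measurable_config_image)
qed

text \<open>The classical construction of the process on a space of finite intensity: a Poisson
  number of independent uniform points.\<close>

definition poisson_law :: "real \<Rightarrow> real measure measure" where
  "poisson_law r = measure_pmf (poisson_pmf r) \<bind> config_law"

lemma measurable_config_law: "config_law \<in> measurable (measure_pmf p) (subprob_algebra point_space)"
  using prob_space_config_law by (auto simp: space_subprob_algebra prob_space_imp_subprob_space)

lemma prob_space_poisson_law: "prob_space (poisson_law r)"
  unfolding poisson_law_def
  by (rule measure_pmf.prob_space_bind[OF _ measurable_config_law]) (simp add: prob_space_config_law)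

lemma sets_poisson_law [simp]: "sets (poisson_law r) = sets point_space"
  unfolding poisson_law_def by (subst sets_bind[of _ _ point_space]) auto

lemma space_poisson_law [simp]: "space (poisson_law r) = simple_point_measures"
  using sets_eq_imp_space_eq[OF sets_poisson_law] by (simp add: space_point_space)

lemma void_event_in_sets:
  "A \<in> sets unit_borel \<Longrightarrow> {\<nu> \<in> simple_point_measures. emeasure \<nu> A = 0} \<in> sets point_space"
  unfolding sets_point_space by (intro sigma_sets.Basic void_eventsI) auto

lemma count_event_in_sets:
  assumes "A \<in> sets unit_borel" "B \<in> sets borel"
  shows "{\<nu> \<in> simple_point_measures. emeasure \<nu> A \<in> B} \<in> sets point_space"
  using measurable_sets[OF measurable_count[OF assms(1)] assms(2)]
  by (simp add: space_point_space vimage_def Int_def conj_commute)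

lemma config_law_void:
  assumes A: "A \<in> sets unit_borel"
  shows "measure (config_law n) {\<nu> \<in> simple_point_measures. emeasure \<nu> A = 0} = (1 - measure lborel A) ^ n"
proof -
  have "measure (config_law n) {\<nu> \<in> simple_point_measures. emeasure \<nu> A = 0} =
    measure (iid_uniform {..<n}) {x \<in> space (iid_uniform {..<n}). emeasure (config (x ` {..<n})) A = 0}"
    by (rule measure_config_law[OF void_event_in_sets[OF A]])
  also have "{x \<in> space (iid_uniform {..<n}). emeasure (config (x ` {..<n})) A = 0} =
      {x \<in> space (iid_uniform {..<n}). \<forall>i\<in>{..<n}. x i \<in> {0..1} - A}"
    using config_image_void_iff[of "{..<n}" _ A] A by (auto simp: space_PiM space_unit_lborel PiE_iff)
  also have "measure (iid_uniform {..<n}) \<dots> = (\<Prod>i<n. measure lborel ({0..1} - A))"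
    using A by (intro measure_iid_box(2)) auto
  finally show ?thesis
    using A by (simp add: measure_lborel_unit del: sets_unit_borel_iff)
qed

text \<open>Off the null set of ties, the number of points in \<open>A\<close> is the number of
  indices whose coordinate lies in \<open>A\<close>. The event therefore splits, up to a null set,
  according to the set \<open>J\<close> of these indices, which gives a binomial law.\<close>

lemma config_law_count:
  assumes A: "A \<in> sets unit_borel"
  shows "measure (config_law n) {\<nu> \<in> simple_point_measures. emeasure \<nu> A = of_nat k} =
    real (n choose k) * measure lborel A ^ k * (1 - measure lborel A) ^ (n - k)"
proof -
  let ?P = "iid_uniform {..<n}"
  define E where "E J = {x \<in> space ?P. \<forall>i\<in>{..<n}. x i \<in> (if i \<in> J then A else {0..1} - A)}" for J
  define \<J> where "\<J> = {J. J \<subseteq> {..<n} \<and> card J = k}"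
  have [measurable]: "A \<in> sets borel" using A by simp
  have fin: "finite \<J>" by (rule finite_subset[of _ "Pow {..<n}"]) (auto simp: \<J>_def)
  have ms: "E J \<in> sets ?P" for J
    unfolding E_def using A by (intro measure_iid_box(1)) auto
  have "measure (config_law n) {\<nu> \<in> simple_point_measures. emeasure \<nu> A = of_nat k} =
    measure ?P {x \<in> space ?P. emeasure (config (x ` {..<n})) A = of_nat k}"
    by (rule measure_config_law) (use count_event_in_sets[OF A, of "{of_nat k}"] in simp)
  also have "\<dots> = measure ?P (\<Union>J\<in>\<J>. E J)"
  proof (rule measure_eq_AE)
    show "AE x in ?P. x \<in> {x \<in> space ?P. emeasure (config (x ` {..<n})) A = of_nat k} \<longleftrightarrow> x \<in> (\<Union>J\<in>\<J>. E J)"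
    proof (rule AE_mp[OF AE_iid_inj AE_I2, rule_format])
      fix x assume x: "x \<in> space ?P" and inj: "inj_on x {..<n}"
      define J where "J = {i\<in>{..<n}. x i \<in> A}"
      have "x ` {..<n} \<inter> A = x ` J" by (auto simp: J_def)
      then have "card (x ` {..<n} \<inter> A) = card J"
        by (simp only:) (intro card_image inj_on_subset[OF inj], auto simp: J_def)
      then have "emeasure (config (x ` {..<n})) A = of_nat (card J)"
        using image_iid[OF x] A by (subst emeasure_config) auto
      moreover have "x \<in> E L \<longleftrightarrow> L = J" if "L \<subseteq> {..<n}" for L
      proof -
        have "x i \<in> {0..1}" if "i < n" for i using image_iid[OF x] that by blast
        then have "x \<in> E L \<longleftrightarrow> (\<forall>i<n. i \<in> L \<longleftrightarrow> x i \<in> A)"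
          using x by (simp add: E_def Ball_def) blast
        then show ?thesis using that by (auto simp: J_def)
      qed
      ultimately show "x \<in> {x \<in> space ?P. emeasure (config (x ` {..<n})) A = of_nat k} \<longleftrightarrow> x \<in> (\<Union>J\<in>\<J>. E J)"
        using x by (auto simp: \<J>_def J_def)
    qed simp
    have [measurable]: "(\<lambda>x. emeasure (config (x ` {..<n})) A) \<in> borel_measurable ?P"
      using measurable_comp[OF measurable_config_image measurable_count[OF A], of "{..<n}"]
      by (simp add: o_def)
    show "{x \<in> space ?P. emeasure (config (x ` {..<n})) A = of_nat k} \<in> sets ?P"
      by measurable
    show "(\<Union>J\<in>\<J>. E J) \<in> sets ?P" using ms fin by auto
  qed
  also have "\<dots> = (\<Sum>J\<in>\<J>. measure ?P (E J))"
  proof (rule finite_measure.finite_measure_finite_Union[OF prob_space.finite_measure[OF prob_space_iid] fin])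
    show "E ` \<J> \<subseteq> sets ?P" using ms by auto
    show "disjoint_family_on E \<J>"
      by (auto simp: disjoint_family_on_def E_def \<J>_def split: if_splits)
  qed
  also have "\<dots> = (\<Sum>J\<in>\<J>. measure lborel A ^ k * (1 - measure lborel A) ^ (n - k))"
  proof (rule sum.cong[OF refl])
    fix J assume "J \<in> \<J>"
    then have J: "J \<subseteq> {..<n}" "card J = k" "finite J" by (auto simp: \<J>_def intro: finite_subset)
    have "measure ?P (E J) = (\<Prod>i<n. measure lborel (if i \<in> J then A else {0..1} - A))"
      unfolding E_def using A by (intro measure_iid_box(2)) auto
    also have "\<dots> = (\<Prod>i<n. if i \<in> J then measure lborel A else 1 - measure lborel A)"
      using A by (intro prod.cong) (auto simp: measure_lborel_unit simp del: sets_unit_borel_iff)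
    also have "\<dots> = measure lborel A ^ card ({..<n} \<inter> J) * (1 - measure lborel A) ^ card ({..<n} - J)"
      by (simp add: prod.If_cases Diff_eq)
    also have "card ({..<n} - J) = n - k" using J by (simp add: card_Diff_subset)
    finally show "measure ?P (E J) = measure lborel A ^ k * (1 - measure lborel A) ^ (n - k)"
      using J by (simp add: Int_absorb1)
  qed
  also have "\<dots> = real (n choose k) * (measure lborel A ^ k * (1 - measure lborel A) ^ (n - k))"
    using n_subsets[of "{..<n}" k] by (simp add: \<J>_def)
  finally show ?thesis by simp
qed

text \<open>The generating function of the Poisson distribution at \<open>b\<close>. With
  \<open>b = 1 - measure lborel A\<close> it produces void probabilities, with \<open>b = 1\<close>
  the total mass.\<close>

lemma poisson_weights_sums:
  fixes r b :: real
  shows "(\<lambda>n. r ^ n / fact n * exp (- r) * b ^ n) sums exp (- (r * (1 - b)))"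
proof -
  have "(\<lambda>n. (r * b) ^ n / fact n * exp (- r)) sums (exp (r * b) * exp (- r))"
    using exp_converges[of "r * b"] by (intro sums_mult2) (simp add: divide_inverse mult_ac)
  then show ?thesis
    by (simp add: power_mult_distrib algebra_simps flip: exp_add)
qed

section \<open>The canonical Poisson process, its counts and its characterisation by void
  probabilities\<close>

context
  fixes r :: real assumes r: "r > 0"
begin

lemma poisson_law_sums:
  assumes E: "E \<in> sets point_space"
  shows "(\<lambda>n. r ^ n / fact n * exp (- r) * measure (config_law n) E) sums measure (poisson_law r) E"
proof -
  interpret P: prob_space "poisson_law r" by (rule prob_space_poisson_law)
  have "ennreal (measure (poisson_law r) E) = emeasure (poisson_law r) E"
    by (simp add: P.emeasure_eq_measure)
  also have "\<dots> = (\<integral>\<^sup>+n. emeasure (config_law n) E \<partial>poisson_pmf r)"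
    unfolding poisson_law_def by (rule emeasure_bind[OF _ measurable_config_law E]) simp
  also have "\<dots> = (\<Sum>n. ennreal (r ^ n / fact n * exp (- r)) * emeasure (config_law n) E)"
    using r by (simp add: nn_integral_measure_pmf nn_integral_count_space_nat)
  also have "\<dots> = (\<Sum>n. ennreal (r ^ n / fact n * exp (- r) * measure (config_law n) E))"
    using r by (simp add: finite_measure.emeasure_eq_measure prob_space.finite_measure[OF prob_space_config_law]
        ennreal_mult'' del: times_divide_eq_left)
  finally have "(\<lambda>n. ennreal (r ^ n / fact n * exp (- r) * measure (config_law n) E)) sums
      ennreal (measure (poisson_law r) E)"
    by (simp only: sums_iff summableI simp_thms)
  then show ?thesis
    using r by (subst (asm) sums_ennreal) auto
qed

lemma poisson_law_void:
  assumes A: "A \<in> sets unit_borel"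
  shows "measure (poisson_law r) {\<nu> \<in> simple_point_measures. emeasure \<nu> A = 0} =
    exp (- (r * measure lborel A))"
proof -
  have "(\<lambda>n. r ^ n / fact n * exp (- r) * (1 - measure lborel A) ^ n) sums
    measure (poisson_law r) {\<nu> \<in> simple_point_measures. emeasure \<nu> A = 0}"
    using poisson_law_sums[OF void_event_in_sets[OF A]] by (simp add: config_law_void[OF A])
  moreover have "(\<lambda>n. r ^ n / fact n * exp (- r) * (1 - measure lborel A) ^ n) sums
    exp (- (r * measure lborel A))"
    using poisson_weights_sums[of r "1 - measure lborel A"] by simp
  ultimately show ?thesis by (rule sums_unique2)
qed

lemma poisson_law_count:
  assumes A: "A \<in> sets unit_borel"
  shows "measure (poisson_law r) {\<nu> \<in> simple_point_measures. emeasure \<nu> A = of_nat k} =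
    (r * measure lborel A) ^ k / fact k * exp (- (r * measure lborel A))"
proof -
  define a where "a = measure lborel A"
  define f where "f n = r ^ n / fact n * exp (- r) * (real (n choose k) * a ^ k * (1 - a) ^ (n - k))" for n
  have 1: "f sums measure (poisson_law r) {\<nu> \<in> simple_point_measures. emeasure \<nu> A = of_nat k}"
    using poisson_law_sums[OF count_event_in_sets[OF A, of "{of_nat k}"]]
    by (simp add: config_law_count[OF A] f_def[abs_def] a_def)
  \<comment> \<open>Fewer than \<open>k\<close> points contribute nothing. After the shift by
    \<open>k\<close> the binomial coefficient cancels the factorial, and a generating function in
    \<open>1 - a\<close> remains.\<close>
  have "f (m + k) = (r * a) ^ k / fact k * (r ^ m / fact m * exp (- r) * (1 - a) ^ m)" for m
    by (simp add: f_def binomial_fact power_add power_mult_distrib)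
  then have "(\<lambda>m. f (m + k)) sums ((r * a) ^ k / fact k * exp (- (r * (1 - (1 - a)))))"
    by (simp only:) (intro sums_mult poisson_weights_sums)
  then have 2: "f sums ((r * a) ^ k / fact k * exp (- (r * (1 - (1 - a)))))"
    by (subst (asm) sums_zero_iff_shift) (simp_all add: f_def binomial_eq_0)
  from sums_unique2[OF 1 2] show ?thesis
    by (simp add: a_def)
qed

text \<open>Renyi's theorem fixes the law, so the counts can be read off from
  \<open>poisson_law\<close>. Independence also follows from void probabilities: those of disjoint
  sets multiply because \<open>exp\<close> turns additivity of Lebesgue measure into a product, and
  void events form intersection-stable generators. This reduces the analysis of the thinned process
  to a single series.\<close>

theorem poisson_process_if_void:
  fixes M :: "'a measure"
  assumes M: "prob_space M" and X: "X \<in> measurable M point_space"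
    and void: "\<And>A. A \<in> sets unit_borel \<Longrightarrow>
      measure M {\<omega>\<in>space M. emeasure (X \<omega>) A = 0} = exp (- (r * measure lborel A))"
  shows "distr M point_space X = poisson_law r" and "poisson_process r M X"
proof -
  interpret M: prob_space M by fact
  have XS: "X \<omega> \<in> simple_point_measures" if "\<omega> \<in> space M" for \<omega>
    using measurable_space[OF X that] by (simp add: space_point_space)
  have md: "measure (distr M point_space X) {\<nu> \<in> simple_point_measures. Q \<nu>} = measure M {\<omega>\<in>space M. Q (X \<omega>)}"
    if "{\<nu> \<in> simple_point_measures. Q \<nu>} \<in> sets point_space" for Q
    using that XS by (subst measure_distr[OF X that]) (auto intro!: arg_cong[of _ _ "measure M"])
  show law: "distr M point_space X = poisson_law r"
  proof (rule point_law_eqI)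
    show D: "prob_space (distr M point_space X)" by (rule M.prob_space_distr[OF X])
    fix A assume A: "A \<in> sets unit_borel"
    show "emeasure (distr M point_space X) {\<nu> \<in> simple_point_measures. emeasure \<nu> A = 0} =
        emeasure (poisson_law r) {\<nu> \<in> simple_point_measures. emeasure \<nu> A = 0}"
      using md[OF void_event_in_sets[OF A]] void[OF A] poisson_law_void[OF A]
      by (simp add: finite_measure.emeasure_eq_measure prob_space.finite_measure D prob_space_poisson_law)
  qed (simp_all add: prob_space_poisson_law)
  have cX: "(\<lambda>\<omega>. emeasure (X \<omega>) A) \<in> borel_measurable M" if "A \<in> sets unit_borel" for A
    using measurable_comp[OF X measurable_count[OF that]] by (simp add: o_def)
  have indep: "M.indep_vars (\<lambda>_. borel) (\<lambda>i \<omega>. emeasure (X \<omega>) (A i)) {..<n}"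
    if A: "\<forall>i<n. A i \<in> sets unit_borel" and disj: "disjoint_family_on A {..<n}" for A and n :: nat
  proof -
    define G where "G i = {X -` V \<inter> space M | V. V \<in> void_events (A i)}" for i
    have G: "\<exists>C. C \<in> sets unit_borel \<and> C \<subseteq> A i \<and> B = {\<omega>\<in>space M. emeasure (X \<omega>) C = 0}"
      if "B \<in> G i" for B i
    proof -
      from that obtain C where C: "C \<in> sets unit_borel" "C \<subseteq> A i"
          and B: "B = X -` {\<nu> \<in> simple_point_measures. emeasure \<nu> C = 0} \<inter> space M"
        unfolding G_def void_events_def by blast
      have "B = {\<omega>\<in>space M. emeasure (X \<omega>) C = 0}"
        unfolding B using XS by auto
      with C show ?thesis by blast
    qed
    have "M.indep_sets G {..<n}"
    proof (rule M.indep_setsI)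
      fix i
      show "G i \<subseteq> sets M"
      proof
        fix B assume "B \<in> G i"
        from G[OF this] obtain C where C: "C \<in> sets unit_borel" "B = {\<omega>\<in>space M. emeasure (X \<omega>) C = 0}" by blast
        show "B \<in> sets M"
          unfolding C(2) using cX[OF C(1)] by measurable
      qed
    next
      fix B J assume J: "J \<noteq> {}" "J \<subseteq> {..<n}" "finite J" and B: "\<forall>j\<in>J. B j \<in> G j"
      have "\<forall>j\<in>J. \<exists>C. C \<in> sets unit_borel \<and> C \<subseteq> A j \<and> B j = {\<omega>\<in>space M. emeasure (X \<omega>) C = 0}"
        using B G by blast
      from bchoice[OF this] obtain C where "\<forall>j\<in>J. C j \<in> sets unit_borel \<and> C j \<subseteq> A j \<and>
          B j = {\<omega>\<in>space M. emeasure (X \<omega>) (C j) = 0}" by blast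
      then have C: "\<And>j. j \<in> J \<Longrightarrow> C j \<in> sets unit_borel" "\<And>j. j \<in> J \<Longrightarrow> C j \<subseteq> A j"
          "\<And>j. j \<in> J \<Longrightarrow> B j = {\<omega>\<in>space M. emeasure (X \<omega>) (C j) = 0}"
        by blast+
      have U: "(\<Union>j\<in>J. C j) \<in> sets unit_borel"
        using C(1) J(3) by (rule sets.finite_UN[rotated])
      have "disjoint_family_on C J"
        unfolding disjoint_family_on_def
      proof (intro ballI impI)
        fix i j assume ij: "i \<in> J" "j \<in> J" "i \<noteq> j"
        then have "A i \<inter> A j = {}" using disj J(2) unfolding disjoint_family_on_def by blast
        then show "C i \<inter> C j = {}" using C(2)[OF ij(1)] C(2)[OF ij(2)] by blast
      qed
      moreover have "C ` J \<subseteq> sets lborel" using C(1) by auto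
      moreover have "emeasure lborel (C j) \<noteq> \<infinity>" if "j \<in> J" for j
        using measure_lborel_unit(3)[OF C(1)[OF that]] by simp
      ultimately have "measure lborel (\<Union>j\<in>J. C j) = (\<Sum>j\<in>J. measure lborel (C j))"
        using J(3) by (intro measure_finite_Union)
      moreover have "(\<Inter>j\<in>J. B j) = {\<omega>\<in>space M. emeasure (X \<omega>) (\<Union>j\<in>J. C j) = 0}"
      proof -
        have "(emeasure (X \<omega>) (\<Union>j\<in>J. C j) = 0) \<longleftrightarrow> (\<forall>j\<in>J. emeasure (X \<omega>) (C j) = 0)"
          if "\<omega> \<in> space M" for \<omega>
          unfolding emeasure_eq_0_iff_points[OF XS[OF that] U]
          using emeasure_eq_0_iff_points[OF XS[OF that] C(1)] by blast
        then show ?thesis using C(3) J(1) by blast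
      qed
      ultimately show "M.prob (\<Inter>j\<in>J. B j) = (\<Prod>j\<in>J. M.prob (B j))"
        using J(3) C by (simp add: void[OF U] void sum_distrib_left exp_sum flip: sum_negf del: sets_unit_borel_iff)
    qed
    moreover have "Int_stable (G i)" for i
    proof (rule Int_stableI)
      fix B C assume "B \<in> G i" "C \<in> G i"
      then obtain V W where VW: "V \<in> void_events (A i)" "W \<in> void_events (A i)"
          "B = X -` V \<inter> space M" "C = X -` W \<inter> space M"
        by (auto simp: G_def)
      then have "B \<inter> C = X -` (V \<inter> W) \<inter> space M" by auto
      moreover have "V \<inter> W \<in> void_events (A i)"
        using Int_stable_void_events VW by (auto simp: Int_stable_def)
      ultimately show "B \<inter> C \<in> G i" unfolding G_def by blast
    qed
    ultimately have I: "M.indep_sets (\<lambda>i. sigma_sets (space M) (G i)) {..<n}"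
      by (rule M.indep_sets_sigma)
    \<comment> \<open>By \<open>measurable_count_void\<close>, the count on \<open>A i\<close> is
      determined by void events of subsets of \<open>A i\<close>, so its events lie in the
      sigma-algebra generated by \<open>G i\<close>.\<close>
    have "M.indep_sets (\<lambda>i. {(\<lambda>\<omega>. emeasure (X \<omega>) (A i)) -` B \<inter> space M | B. B \<in> sets borel}) {..<n}"
    proof (rule M.indep_sets_mono_sets[OF I], safe)
      fix i and B :: "ennreal set" assume i: "i < n" and B: "B \<in> sets borel"
      define V where "V = (\<lambda>\<nu>. emeasure \<nu> (A i)) -` B \<inter> simple_point_measures"
      have "V \<in> sigma_sets simple_point_measures (void_events (A i))"
        using measurable_sets[OF measurable_count_void B, of "A i"] A i
        by (simp add: V_def space_measure_of sets_measure_of void_events_subset)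
      then have "X -` V \<inter> space M \<in>
          {X -` W \<inter> space M | W. W \<in> sigma_sets simple_point_measures (void_events (A i))}"
        by blast
      also have "\<dots> = sigma_sets (space M) (G i)"
        unfolding G_def by (rule sigma_sets_vimage_commute) (use XS in blast)
      also have "X -` V \<inter> space M = (\<lambda>\<omega>. emeasure (X \<omega>) (A i)) -` B \<inter> space M"
        using XS by (auto simp: V_def)
      finally show "(\<lambda>\<omega>. emeasure (X \<omega>) (A i)) -` B \<inter> space M \<in> sigma_sets (space M) (G i)" .
    qed
    then show ?thesis
      using A cX by (auto simp: M.indep_vars_def2 simp del: sets_unit_borel_iff)
  qed
  have "measure M {\<omega>\<in>space M. emeasure (X \<omega>) A = of_nat k} =
      (r * measure lborel A) ^ k / fact k * exp (- (r * measure lborel A))"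
    if A: "A \<in> sets unit_borel" for A k
  proof -
    have "{\<nu> \<in> simple_point_measures. emeasure \<nu> A = of_nat k} \<in> sets point_space"
      using count_event_in_sets[OF A, of "{of_nat k}"] by simp
    from md[OF this] show ?thesis unfolding law poisson_law_count[OF A] by (rule sym)
  qed
  then show "poisson_process r M X"
    unfolding poisson_process_def using M X indep by blast
qed

text \<open>Existence of the process. Without it \<open>thinning\<close> could hold vacuously, and
  there would be nothing to contradict in the negative part.\<close>

lemma poisson_process_law: "poisson_process r (poisson_law r) (\<lambda>\<nu>. \<nu>)"
proof (rule poisson_process_if_void(2))
  show "prob_space (poisson_law r)" by (rule prob_space_poisson_law)
  show "(\<lambda>\<nu>. \<nu>) \<in> measurable (poisson_law r) point_space"
    by (rule measurable_ident_sets) simp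
  show "measure (poisson_law r) {\<nu>\<in>space (poisson_law r). emeasure \<nu> A = 0} = exp (- (r * measure lborel A))"
    if "A \<in> sets unit_borel" for A
    using poisson_law_void[OF that] by simp
qed

text \<open>Uniqueness in law. It lets the arbitrary process quantified over in
  \<open>thinning\<close> be replaced by the canonical one.\<close>

lemma poisson_process_distr:
  assumes "poisson_process r M X"
  shows "distr M point_space X = poisson_law r"
proof (rule poisson_process_if_void)
  show "prob_space M" "X \<in> measurable M point_space" using assms by (auto simp: poisson_process_def)
  fix A assume "A \<in> sets unit_borel"
  then have "measure M {\<omega>\<in>space M. emeasure (X \<omega>) A = of_nat 0} =
      (r * measure lborel A) ^ 0 / fact 0 * exp (- (r * measure lborel A))"
    using assms unfolding poisson_process_def by blast
  then show "measure M {\<omega>\<in>space M. emeasure (X \<omega>) A = 0} = exp (- (r * measure lborel A))"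
    by simp
qed

end

subsection \<open>Marking one point of a finite set\<close>

text \<open>While \<open>u\<close> runs through a cell of length \<open>1 / N\<close>, the value
  \<open>N * u + b\<close> sweeps exactly one period, so its fractional part is uniformly
  distributed, whatever the offset \<open>b\<close> is.\<close>

lemma emeasure_frac_cell:
  fixes N b p q :: real and j :: int
  assumes N: "N > 0" and pq: "0 \<le> p" "p \<le> q" "q \<le> 1"
  shows "{u. \<lfloor>N * u\<rfloor> = j \<and> frac (N * u + b) \<in> {p..<q}} \<in> sets borel"
    and "emeasure lborel {u. \<lfloor>N * u\<rfloor> = j \<and> frac (N * u + b) \<in> {p..<q}} = ennreal ((q - p) / N)"
proof -
  define c where "c = frac b"
  have c: "0 \<le> c" "c < 1" by (auto simp: c_def frac_lt_1)
  \<comment> \<open>Relative to the cell, scaled to unit length, the fractional part starts at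
    \<open>c\<close> and wraps around at \<open>1 - c\<close>. The first interval is the part of the
    preimage before the wrap, the second the part after it; clipping at 0 and 1 makes either one
    empty if necessary.\<close>
  define l1 u1 l2 u2 where "l1 = max 0 (p - c)" and "u1 = max 0 (q - c)"
    and "l2 = min 1 (p - c + 1)" and "u2 = min 1 (q - c + 1)"
  note defs = l1_def u1_def l2_def u2_def
  have frac: "frac (N * u + b) = (if N * u - j + c < 1 then N * u - j + c else N * u - j + c - 1)"
    if "j \<le> N * u" "N * u < j + 1" for u
  proof -
    have "N * u + b - (N * u - j + c) = of_int (j + \<lfloor>b\<rfloor>)"
      "N * u + b - (N * u - j + c - 1) = of_int (j + \<lfloor>b\<rfloor> + 1)"
      by (simp_all add: c_def frac_def)
    then have "N * u + b - (N * u - j + c) \<in> \<int>" "N * u + b - (N * u - j + c - 1) \<in> \<int>"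
      by (metis Ints_of_int)+
    then show ?thesis
      using that c by (auto simp: frac_unique_iff)
  qed
  have "u \<in> {u. \<lfloor>N * u\<rfloor> = j \<and> frac (N * u + b) \<in> {p..<q}} \<longleftrightarrow>
      u \<in> {(j + l1) / N..<(j + u1) / N} \<union> {(j + l2) / N..<(j + u2) / N}" for u
  proof -
    define w where "w = N * u"
    have "u \<in> {(j + l) / N..<(j + r) / N} \<longleftrightarrow> j + l \<le> w \<and> w < j + r" for l r :: real
      using N by (simp add: w_def field_simps)
    then have rhs: "u \<in> {(j + l1) / N..<(j + u1) / N} \<union> {(j + l2) / N..<(j + u2) / N} \<longleftrightarrow>
        j + l1 \<le> w \<and> w < j + u1 \<or> j + l2 \<le> w \<and> w < j + u2"
      by blast
    have floor: "\<lfloor>N * u\<rfloor> = j \<longleftrightarrow> j \<le> w \<and> w < real_of_int j + 1"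
      by (simp add: floor_eq_iff w_def)
    show ?thesis
    proof (cases "j \<le> w \<and> w < real_of_int j + 1")
      case True
      then have "frac (N * u + b) = (if w - j + c < 1 then w - j + c else w - j + c - 1)"
        using frac[of u] unfolding w_def by simp
      then show ?thesis
        unfolding mem_Collect_eq rhs floor using True c pq
        by (cases "w - j + c < 1") (auto simp: defs max_def min_def)
    next
      case False
      have "0 \<le> l1" "u1 \<le> 1" "0 \<le> l2" "u2 \<le> 1"
        using c pq by (simp_all add: defs)
      then have "\<not> (j + l1 \<le> w \<and> w < j + u1)" "\<not> (j + l2 \<le> w \<and> w < j + u2)"
        using False by linarith+
      then show ?thesis
        unfolding mem_Collect_eq rhs floor using False by blast
    qed
  qed
  then have eq: "{u. \<lfloor>N * u\<rfloor> = j \<and> frac (N * u + b) \<in> {p..<q}} =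
      {(j + l1) / N..<(j + u1) / N} \<union> {(j + l2) / N..<(j + u2) / N}"
    by blast
  show "{u. \<lfloor>N * u\<rfloor> = j \<and> frac (N * u + b) \<in> {p..<q}} \<in> sets borel"
    unfolding eq by simp
  have le: "l1 \<le> u1" "u1 \<le> l2" "l2 \<le> u2" and sum: "u1 - l1 + (u2 - l2) = q - p"
    using c pq by (auto simp: defs)
  have "(j + l1) / N \<le> (j + u1) / N" "(j + u1) / N \<le> (j + l2) / N" "(j + l2) / N \<le> (j + u2) / N"
    using le N by (auto intro!: divide_right_mono)
  then have "emeasure lborel ({(j + l1) / N..<(j + u1) / N} \<union> {(j + l2) / N..<(j + u2) / N}) =
      ennreal ((j + u1) / N - (j + l1) / N) + ennreal ((j + u2) / N - (j + l2) / N)"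
    by (subst plus_emeasure[symmetric]) auto
  also have "\<dots> = ennreal ((j + u1) / N - (j + l1) / N + ((j + u2) / N - (j + l2) / N))"
    using le N by (intro ennreal_plus[symmetric]) (auto simp: divide_right_mono)
  also have "(j + u1) / N - (j + l1) / N + ((j + u2) / N - (j + l2) / N) = (q - p) / N"
    unfolding sum[symmetric] by (simp add: diff_divide_distrib add_divide_distrib)
  finally show "emeasure lborel {u. \<lfloor>N * u\<rfloor> = j \<and> frac (N * u + b) \<in> {p..<q}} = ennreal ((q - p) / N)"
    unfolding eq .
qed

section \<open>A random mark from low-order digits\<close>

definition dyadic_level :: "real set \<Rightarrow> nat" where
  "dyadic_level S = (LEAST k. inj_on (\<lambda>x. \<lfloor>2 ^ k * x\<rfloor>) S)"

text \<open>Scaling and taking the fractional part discard the digits that already separate, and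
  hence order, the points. The sum treats the points symmetrically and, with all points but one
  fixed, is a shift of the remaining one, which is the situation of
  \<open>emeasure_frac_cell\<close>.\<close>

definition hash :: "real set \<Rightarrow> real" where
  "hash S = frac (2 ^ dyadic_level S * \<Sum>S)"

definition rank :: "real set \<Rightarrow> real \<Rightarrow> nat" where
  "rank S x = card {y \<in> S. y < x}"

text \<open>Given the other points of S, the hash is uniform on [0,1] as x ranges over a cell of
  the dyadic level of S, while the level and the rank of x stay constant. Hence x is marked with
  conditional probability a / card S, irrespective of the other points.\<close>
definition marked :: "real \<Rightarrow> real set \<Rightarrow> real \<Rightarrow> bool" where
  "marked a S x \<longleftrightarrow> hash S \<in> {a * (rank S x / card S)..<a * (Suc (rank S x) / card S)}"

text \<open>Points of different rank own disjoint subintervals of [0,a). A hash in the rest of [0,1)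
  marks no point at all.\<close>

lemma marked_unique:
  assumes "finite S" "a \<ge> 0" "x \<in> S" "y \<in> S" "marked a S x" "marked a S y"
  shows "x = y"
proof -
  have False if "u < v" "u \<in> S" "v \<in> S" "marked a S u" "marked a S v" for u v
  proof -
    have "{w \<in> S. w < u} \<subset> {w \<in> S. w < v}" using that by auto
    then have "Suc (rank S u) \<le> rank S v"
      unfolding rank_def Suc_le_eq using assms(1) by (intro psubset_card_mono) auto
    then have "a * (Suc (rank S u) / card S) \<le> a * (rank S v / card S)"
      using assms(2) by (intro mult_left_mono divide_right_mono) auto
    then show False using that by (auto simp: marked_def simp del: of_nat_Suc)
  qed
  then show ?thesis using assms by (metis linorder_neqE_linordered_idom)
qed

text \<open>Dyadic cells are nested: a coarse index is the integer quotient of a fine one by a power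
  of two.\<close>

lemma floor_dyadic_mono:
  fixes x y :: real
  assumes "\<lfloor>2 ^ k * x\<rfloor> = \<lfloor>2 ^ k * y\<rfloor>" "l \<le> k"
  shows "\<lfloor>2 ^ l * x\<rfloor> = \<lfloor>2 ^ l * y\<rfloor>"
proof -
  have "\<lfloor>2 ^ l * z\<rfloor> = \<lfloor>2 ^ k * z\<rfloor> div 2 ^ (k - l)" for z :: real
  proof -
    have "(2::real) ^ k = 2 ^ l * 2 ^ (k - l)"
      using assms(2) by (simp flip: power_add)
    then have "2 ^ l * z = 2 ^ k * z / of_int (2 ^ (k - l))"
      by simp
    then show ?thesis
      using floor_divide_real_eq_div[of "2 ^ (k - l)" "2 ^ k * z"] by simp
  qed
  then show ?thesis using assms(1) by simp
qed

lemma dyadic_level_inj: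
  assumes "finite S"
  shows "inj_on (\<lambda>x. \<lfloor>2 ^ dyadic_level S * x\<rfloor>) S"
proof -
  obtain k where "inj_on (\<lambda>x. \<lfloor>2 ^ k * x\<rfloor>) S"
    using eventually_inj_on_dyadic[OF assms] by (auto simp: eventually_sequentially)
  then show ?thesis unfolding dyadic_level_def by (rule LeastI)
qed

text \<open>The scale used by \<open>hash\<close> depends on the point being varied, so its
  stability has to be secured. Moving \<open>u\<close> inside its cell changes no cell index at the
  same or a coarser level, so the minimal separating level is the same; and since no point of
  \<open>R\<close> lies in that cell, \<open>u\<close> passes none of them.\<close>

lemma dyadic_level_cell:
  assumes R: "finite R" and u: "u \<notin> R" and v: "\<lfloor>2 ^ dyadic_level (insert u R) * v\<rfloor> = \<lfloor>2 ^ dyadic_level (insert u R) * u\<rfloor>"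
  shows "v \<notin> R" "dyadic_level (insert v R) = dyadic_level (insert u R)" "rank (insert v R) v = rank (insert u R) u"
proof -
  define k where "k = dyadic_level (insert u R)"
  have inj: "inj_on (\<lambda>x. \<lfloor>2 ^ k * x\<rfloor>) (insert u R)"
    unfolding k_def using R by (intro dyadic_level_inj) simp
  have sep: "\<lfloor>2 ^ k * u\<rfloor> \<noteq> \<lfloor>2 ^ k * y\<rfloor>" if "y \<in> R" for y
    using inj that u by (auto simp: inj_on_def)
  then show v_R: "v \<notin> R" using v unfolding k_def by metis
  have *: "inj_on (\<lambda>x. \<lfloor>2 ^ l * x\<rfloor>) (insert v R) \<longleftrightarrow> inj_on (\<lambda>x. \<lfloor>2 ^ l * x\<rfloor>) (insert u R)" if "l \<le> k" for l
  proof -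
    have "\<lfloor>2 ^ l * v\<rfloor> = \<lfloor>2 ^ l * u\<rfloor>"
      using v that unfolding k_def by (rule floor_dyadic_mono)
    then show ?thesis using v_R u by (simp add: inj_on_insert)
  qed
  show "dyadic_level (insert v R) = dyadic_level (insert u R)"
    unfolding k_def[symmetric] unfolding dyadic_level_def[of "insert v R"]
  proof (rule Least_equality)
    show "inj_on (\<lambda>x. \<lfloor>2 ^ k * x\<rfloor>) (insert v R)" by (rule iffD2[OF *[OF order_refl] inj])
    fix l assume l: "inj_on (\<lambda>x. \<lfloor>2 ^ l * x\<rfloor>) (insert v R)"
    show "k \<le> l"
    proof (rule ccontr)
      assume "\<not> k \<le> l"
      then have "inj_on (\<lambda>x. \<lfloor>2 ^ l * x\<rfloor>) (insert u R)" using *[of l] l by linarith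
      then have "k \<le> l" unfolding k_def dyadic_level_def by (rule Least_le)
      then show False using \<open>\<not> k \<le> l\<close> by simp
    qed
  qed
  have lt: "y < v \<longleftrightarrow> y < u" if "y \<in> R" for y
  proof -
    have le: "\<lfloor>2 ^ k * y\<rfloor> \<le> \<lfloor>2 ^ k * w\<rfloor>" if "y \<le> w" for y w :: real
      using that by (intro floor_mono) simp
    show ?thesis
      using le[of y u] le[of u y] le[of y v] le[of v y] sep[OF that] v
      unfolding k_def[symmetric] by linarith
  qed
  have "{y \<in> insert v R. y < v} = {y \<in> insert u R. y < u}"
    using lt by auto
  then show "rank (insert v R) v = rank (insert u R) u"
    by (simp add: rank_def)
qed

text \<open>The admissible positions, up to the point 1, split into countably many dyadic cells on
  which level and rank are constant. On each of them the hash is uniform, so the same fraction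
  \<open>a / n\<close> of every cell is marked, and summing over the cells gives the same fraction
  of [0,1].\<close>

lemma emeasure_marked_insert:
  fixes R :: "real set"
  assumes R: "finite R" and a: "0 \<le> a" "a \<le> 1"
  defines "B \<equiv> {u \<in> {0..1}. u \<notin> R \<and> marked a (insert u R) u}"
  shows "B \<in> sets unit_borel" and "emeasure lborel B = ennreal (a / Suc (card R))"
proof -
  define n where "n = Suc (card R)"
  define C where "C = (\<lambda>(k, j). {u :: real. \<lfloor>2 ^ k * u\<rfloor> = (j::int)})"
  define D where "D kj = C kj \<inter> {u. marked a (insert u R) u}" for kj
  define U where "U = {0..<1} - R"
  define J where "J = (\<lambda>u. (dyadic_level (insert u R), \<lfloor>2 ^ dyadic_level (insert u R) * u\<rfloor>)) ` U"
  have C_meas: "C kj \<in> sets lborel" for kj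
    unfolding C_def by (cases kj) (simp, measurable)
  have cell: "v \<in> U \<and> dyadic_level (insert v R) = k \<and> rank (insert v R) v = rank (insert u R) u"
    if u: "u \<in> U" "k = dyadic_level (insert u R)" "j = \<lfloor>2 ^ k * u\<rfloor>" and v: "v \<in> C (k, j)" for u v k j
  proof -
    have eq: "\<lfloor>2 ^ k * v\<rfloor> = \<lfloor>2 ^ k * u\<rfloor>" using u v by (simp add: C_def)
    have "\<lfloor>v\<rfloor> = \<lfloor>u\<rfloor>" using floor_dyadic_mono[OF eq, of 0] by simp
    moreover have "\<lfloor>u\<rfloor> = 0" using u by (auto simp: U_def floor_eq_iff)
    ultimately have "0 \<le> v" "v < 1" by (simp_all add: floor_eq_iff)
    then show ?thesis
      using dyadic_level_cell[OF R, of u v] u eq by (auto simp: U_def)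
  qed
  have UC: "U = (\<Union>kj\<in>J. C kj)"
  proof (intro equalityI subsetI)
    show "v \<in> (\<Union>kj\<in>J. C kj)" if "v \<in> U" for v
      using that by (auto simp: J_def C_def)
    show "v \<in> U" if "v \<in> (\<Union>kj\<in>J. C kj)" for v
      using that cell unfolding J_def by blast
  qed
  have disj: "disjoint_family_on C J"
    unfolding disjoint_family_on_def
  proof (intro ballI impI)
    fix x y assume x: "x \<in> J" and y: "y \<in> J" and "x \<noteq> y"
    show "C x \<inter> C y = {}"
    proof (rule ccontr)
      assume "C x \<inter> C y \<noteq> {}"
      then obtain v where v: "v \<in> C x" "v \<in> C y" by auto
      \<comment> \<open>Cells are disjoint since any point of a cell recovers its label: the level
        belonging to the point, and its index at that level.\<close>
      have "z = (dyadic_level (insert v R), \<lfloor>2 ^ dyadic_level (insert v R) * v\<rfloor>)" if "z \<in> J" "v \<in> C z" for z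
      proof -
        from that(1) obtain u where u: "u \<in> U"
            "z = (dyadic_level (insert u R), \<lfloor>2 ^ dyadic_level (insert u R) * u\<rfloor>)"
          unfolding J_def by blast
        with cell[OF u(1) refl refl, of v] that(2) show ?thesis by (simp add: C_def)
      qed
      then show False using v x y \<open>x \<noteq> y\<close> by metis
    qed
  qed
  have DC: "D kj \<in> sets lborel \<and> emeasure lborel (D kj) = ennreal (a / n) * emeasure lborel (C kj)"
    if "kj \<in> J" for kj
  proof -
    obtain k j where kj: "kj = (k, j)" by (cases kj)
    with that obtain u where u: "u \<in> U" "k = dyadic_level (insert u R)" "j = \<lfloor>2 ^ k * u\<rfloor>"
      by (auto simp: J_def)
    define \<rho> where "\<rho> = rank (insert u R) u"
    have "\<rho> \<le> card R"
      unfolding \<rho>_def rank_def using R by (intro card_mono) auto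
    then have \<rho>: "Suc \<rho> \<le> n" by (simp add: n_def)
    have D: "D kj = {v. \<lfloor>2 ^ k * v\<rfloor> = j \<and> frac (2 ^ k * v + 2 ^ k * \<Sum>R) \<in> {a * (\<rho> / n)..<a * (Suc \<rho> / n)}}"
    proof -
      have "marked a (insert v R) v \<longleftrightarrow> frac (2 ^ k * v + 2 ^ k * \<Sum>R) \<in> {a * (\<rho> / n)..<a * (Suc \<rho> / n)}"
        if "v \<in> C kj" for v
      proof -
        have "v \<notin> R" "dyadic_level (insert v R) = k" "rank (insert v R) v = \<rho>"
          using cell[OF u, of v] that by (auto simp: kj \<rho>_def U_def)
        then show ?thesis
          using R by (simp add: marked_def hash_def n_def distrib_left del: of_nat_Suc)
      qed
      then show ?thesis by (auto simp: D_def kj C_def)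
    qed
    have p: "0 \<le> a * (\<rho> / n)" using a by simp
    have q: "a * (Suc \<rho> / n) \<le> 1"
      using a \<rho> by (intro mult_le_one) (auto simp del: of_nat_Suc simp: n_def)
    have pq: "a * (\<rho> / n) \<le> a * (Suc \<rho> / n)"
      using a by (intro mult_left_mono divide_right_mono) auto
    \<comment> \<open>The entire cell is the case of the interval [0,1), so the same lemma measures
      both the cell and its marked part.\<close>
    have "C kj = {v. \<lfloor>2 ^ k * v\<rfloor> = j \<and> frac (2 ^ k * v + 0) \<in> {0..<1}}"
      by (auto simp: C_def kj frac_lt_1)
    then have "emeasure lborel (C kj) = ennreal ((1 - 0) / 2 ^ k)"
      by (simp only:) (rule emeasure_frac_cell, auto)
    moreover have "D kj \<in> sets lborel"
      unfolding D sets_lborel by (rule emeasure_frac_cell(1)[OF _ p pq q]) simp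
    moreover have "emeasure lborel (D kj) = ennreal ((a * (Suc \<rho> / n) - a * (\<rho> / n)) / 2 ^ k)"
      unfolding D by (rule emeasure_frac_cell(2)[OF _ p pq q]) simp
    moreover have "(a * (Suc \<rho> / n) - a * (\<rho> / n)) / 2 ^ k = a / n * ((1 - 0) / 2 ^ k)"
      by (simp add: add_divide_distrib distrib_left)
    ultimately show ?thesis
      using a by (simp only: ennreal_mult' divide_nonneg_nonneg of_nat_0_le_iff)
  qed
  have cnt: "countable J" unfolding J_def
    by (rule countable_subset[OF subset_UNIV]) simp
  have disjD: "disjoint_family_on D J"
    using disj unfolding D_def disjoint_family_on_def by blast
  have "emeasure lborel (\<Union>kj\<in>J. D kj) = (\<integral>\<^sup>+kj. emeasure lborel (D kj) \<partial>count_space J)"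
    using DC cnt disjD by (intro emeasure_UN_countable) auto
  also have "\<dots> = (\<integral>\<^sup>+kj. ennreal (a / n) * emeasure lborel (C kj) \<partial>count_space J)"
    using DC by (intro nn_integral_cong) simp
  also have "\<dots> = ennreal (a / n) * (\<integral>\<^sup>+kj. emeasure lborel (C kj) \<partial>count_space J)"
    by (rule nn_integral_cmult) simp
  also have "(\<integral>\<^sup>+kj. emeasure lborel (C kj) \<partial>count_space J) = emeasure lborel (\<Union>kj\<in>J. C kj)"
    using C_meas cnt disj by (intro emeasure_UN_countable[symmetric]) auto
  also have "\<dots> = emeasure lborel {0..<1::real}"
  proof -
    have "R \<in> null_sets lborel"
      using R by (intro countable_imp_null_set_lborel countable_finite)
    then show ?thesis
      unfolding UC[symmetric] U_def by (intro emeasure_Diff_null_set) auto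
  qed
  finally have em: "emeasure lborel (\<Union>kj\<in>J. D kj) = ennreal (a / n)" by simp
  have Dm: "(\<Union>kj\<in>J. D kj) \<in> sets lborel"
    using DC cnt by (intro sets.countable_UN') auto
  have DU: "(\<Union>kj\<in>J. D kj) = {u \<in> {0..<1}. u \<notin> R \<and> marked a (insert u R) u}"
    using UC by (auto simp: D_def U_def)
  \<comment> \<open>The cell of the point 1 sticks out of [0,1], so this point was left out of
    \<open>U\<close> and is added back as a null set.\<close>
  have B: "B = (\<Union>kj\<in>J. D kj) \<union> (B \<inter> {1})"
    unfolding DU by (auto simp: B_def)
  have B1: "B \<inter> {1} \<in> null_sets lborel"
    by (rule countable_imp_null_set_lborel) simp
  have "(\<Union>kj\<in>J. D kj) \<union> (B \<inter> {1}) \<in> sets lborel"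
    using Dm B1 by (intro sets.Un) auto
  then have "B \<in> sets lborel"
    by (simp only: B[symmetric])
  moreover have "B \<subseteq> {0..1}" unfolding B_def by blast
  ultimately show "B \<in> sets unit_borel" by simp
  show "emeasure lborel B = ennreal (a / Suc (card R))"
    using em emeasure_Un_null_set[OF Dm B1] unfolding B[symmetric] by (simp add: n_def)
qed

text \<open>Stated for an arbitrary finite family of random variables because it is applied both to
  independent coordinates and to order statistics. For distinct values, expressions in the set of
  points can be rewritten over the fixed index set.\<close>

lemma measurable_marked:
  fixes X :: "'i \<Rightarrow> 'a \<Rightarrow> real"
  assumes I: "finite I" "i \<in> I" and X: "\<And>j. j \<in> I \<Longrightarrow> X j \<in> borel_measurable M"
  shows "{\<omega>\<in>space M. inj_on (\<lambda>j. X j \<omega>) I \<and> marked a ((\<lambda>j. X j \<omega>) ` I) (X i \<omega>)} \<in> sets M"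
proof -
  have [measurable]: "X i \<in> borel_measurable M" using I X by simp
  \<comment> \<open>\<open>L\<close>, \<open>r\<close> and \<open>h\<close> are the indexed versions
    of \<open>dyadic_level\<close>, \<open>rank\<close> and \<open>hash\<close>; they are visibly
    measurable and agree with the originals when the values are distinct.\<close>
  define L where "L \<omega> = (LEAST k. \<forall>j\<in>I. \<forall>l\<in>I. j \<noteq> l \<longrightarrow> \<lfloor>2 ^ k * X j \<omega>\<rfloor> \<noteq> \<lfloor>2 ^ k * X l \<omega>\<rfloor>)" for \<omega>
  define r where "r \<omega> = (\<Sum>j\<in>I. if X j \<omega> < X i \<omega> then 1 else 0 :: real)" for \<omega>
  define h where "h \<omega> = frac (2 ^ L \<omega> * (\<Sum>j\<in>I. X j \<omega>))" for \<omega>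
  have [measurable]: "L \<in> measurable M (count_space UNIV)"
  proof -
    have "Measurable.pred M (\<lambda>\<omega>. \<forall>j\<in>I. \<forall>l\<in>I. j \<noteq> l \<longrightarrow> \<lfloor>2 ^ k * X j \<omega>\<rfloor> \<noteq> \<lfloor>2 ^ k * X l \<omega>\<rfloor>)" for k :: nat
      unfolding pred_def
    proof (intro sets.sets_Collect_finite_All I(1))
      fix j l assume "j \<in> I" "l \<in> I"
      then have [measurable]: "X j \<in> borel_measurable M" "X l \<in> borel_measurable M" using X by auto
      show "{\<omega>\<in>space M. j \<noteq> l \<longrightarrow> \<lfloor>2 ^ k * X j \<omega>\<rfloor> \<noteq> \<lfloor>2 ^ k * X l \<omega>\<rfloor>} \<in> sets M"
        by measurable
    qed
    then show ?thesis
      unfolding L_def by (rule measurable_Least)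
  qed
  have [measurable]: "(\<lambda>\<omega>. 2 ^ L \<omega> :: real) \<in> borel_measurable M"
    by (rule measurable_compose[of L M "count_space UNIV"]) simp_all
  have [measurable]: "(\<lambda>\<omega>. \<Sum>j\<in>I. X j \<omega>) \<in> borel_measurable M"
    using X by (rule borel_measurable_sum)
  have [measurable]: "h \<in> borel_measurable M"
    unfolding h_def frac_def by measurable
  have [measurable]: "r \<in> borel_measurable M"
    unfolding r_def
  proof (rule borel_measurable_sum)
    fix j assume "j \<in> I"
    then have [measurable]: "X j \<in> borel_measurable M" by (rule X)
    show "(\<lambda>\<omega>. if X j \<omega> < X i \<omega> then 1 else 0 :: real) \<in> borel_measurable M"
      by measurable
  qed
  have "{\<omega>\<in>space M. (\<forall>j\<in>I. \<forall>l\<in>I. j \<noteq> l \<longrightarrow> X j \<omega> \<noteq> X l \<omega>) \<and>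
      a * (r \<omega> / card I) \<le> h \<omega> \<and> h \<omega> < a * ((r \<omega> + 1) / card I)} \<in> sets M"
  proof -
    have [measurable]: "Measurable.pred M (\<lambda>\<omega>. \<forall>j\<in>I. \<forall>l\<in>I. j \<noteq> l \<longrightarrow> X j \<omega> \<noteq> X l \<omega>)"
      unfolding pred_def
    proof (intro sets.sets_Collect_finite_All I(1))
      fix j l assume "j \<in> I" "l \<in> I"
      then have [measurable]: "X j \<in> borel_measurable M" "X l \<in> borel_measurable M" using X by auto
      show "{\<omega>\<in>space M. j \<noteq> l \<longrightarrow> X j \<omega> \<noteq> X l \<omega>} \<in> sets M"
        by measurable
    qed
    show ?thesis by measurable
  qed
  also have "{\<omega>\<in>space M. (\<forall>j\<in>I. \<forall>l\<in>I. j \<noteq> l \<longrightarrow> X j \<omega> \<noteq> X l \<omega>) \<and>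
      a * (r \<omega> / card I) \<le> h \<omega> \<and> h \<omega> < a * ((r \<omega> + 1) / card I)} =
    {\<omega>\<in>space M. inj_on (\<lambda>j. X j \<omega>) I \<and> marked a ((\<lambda>j. X j \<omega>) ` I) (X i \<omega>)}"
  proof (intro Collect_cong conj_cong refl)
    fix \<omega>
    show "(\<forall>j\<in>I. \<forall>l\<in>I. j \<noteq> l \<longrightarrow> X j \<omega> \<noteq> X l \<omega>) = inj_on (\<lambda>j. X j \<omega>) I"
      by (auto simp: inj_on_def)
    assume inj: "inj_on (\<lambda>j. X j \<omega>) I"
    let ?S = "(\<lambda>j. X j \<omega>) ` I"
    have "{y \<in> ?S. y < X i \<omega>} = (\<lambda>j. X j \<omega>) ` {j\<in>I. X j \<omega> < X i \<omega>}" by auto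
    then have "rank ?S (X i \<omega>) = card {j\<in>I. X j \<omega> < X i \<omega>}"
      unfolding rank_def using card_image[OF inj_on_subset[OF inj, of "{j\<in>I. X j \<omega> < X i \<omega>}"]] by simp
    moreover have "r \<omega> = (\<Sum>j\<in>{j\<in>I. X j \<omega> < X i \<omega>}. 1)"
      unfolding r_def by (rule sum.inter_filter[symmetric, OF I(1)])
    ultimately have r: "r \<omega> = rank ?S (X i \<omega>)"
      by (simp only: real_of_card)
    have "inj_on (\<lambda>x. \<lfloor>2 ^ k * x\<rfloor>) ?S \<longleftrightarrow> (\<forall>j\<in>I. \<forall>l\<in>I. j \<noteq> l \<longrightarrow> \<lfloor>2 ^ k * X j \<omega>\<rfloor> \<noteq> \<lfloor>2 ^ k * X l \<omega>\<rfloor>)" for k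
      unfolding comp_inj_on_iff[OF inj] by (auto simp: inj_on_def)
    then have "L \<omega> = dyadic_level ?S"
      by (simp add: L_def dyadic_level_def)
    then have "h \<omega> = hash ?S"
      by (simp add: h_def hash_def sum.reindex[OF inj])
    then show "(a * (r \<omega> / card I) \<le> h \<omega> \<and> h \<omega> < a * ((r \<omega> + 1) / card I)) = marked a ?S (X i \<omega>)"
      using r by (simp add: marked_def card_image[OF inj] add.commute)
  qed
  finally show ?thesis .
qed

text \<open>The set \<open>A\<close> is tested on the other coordinates only, since the marked one
  is going to be deleted. Comparing \<open>A\<close> with the empty set isolates the event that a
  surviving point lies in \<open>A\<close>.\<close>

definition marked_event :: "real \<Rightarrow> nat \<Rightarrow> nat \<Rightarrow> real set \<Rightarrow> (nat \<Rightarrow> real) set" where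
  "marked_event a n i A = {x \<in> space (iid_uniform {..<n}).
     (inj_on x {..<n} \<and> marked a (x ` {..<n}) (x i)) \<and> (\<forall>j\<in>{..<n} - {i}. x j \<notin> A)}"

text \<open>The product form expresses that being marked is independent of the other coordinates:
  integrating first over coordinate \<open>i\<close> yields the constant \<open>a / n\<close>, and
  then only the void probability of the other \<open>n - 1\<close> uniform points is left.\<close>

lemma marked_event_prob:
  assumes a: "0 \<le> a" "a \<le> 1" and i: "i < n" and A: "A \<in> sets unit_borel"
  shows "marked_event a n i A \<in> sets (iid_uniform {..<n})"
    and "measure (iid_uniform {..<n}) (marked_event a n i A) = a / n * (1 - measure lborel A) ^ (n - 1)"
proof -
  define K where "K = {..<n} - {i}"
  define E where "E = marked_event a n i A"
  define V where "V = {x \<in> space (iid_uniform K). \<forall>j\<in>K. x j \<notin> A}"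
  have K: "finite K" "i \<notin> K" "insert i K = {..<n}" "card K = n - 1" using i by (auto simp: K_def)
  have void: "{x \<in> space (iid_uniform J). \<forall>j\<in>K. x j \<notin> A} \<in> sets (iid_uniform J)" if "K \<subseteq> J" for J
  proof (intro sets.sets_Collect_finite_All K(1))
    fix j assume "j \<in> K"
    with that have [measurable]: "(\<lambda>x. x j) \<in> borel_measurable (iid_uniform J)"
      by (intro measurable_iid_component) blast
    have [measurable]: "A \<in> sets borel" using A by simp
    show "{x \<in> space (iid_uniform J). x j \<notin> A} \<in> sets (iid_uniform J)"
      by measurable
  qed
  have m: "{x \<in> space (iid_uniform {..<n}). inj_on (\<lambda>j. x j) {..<n} \<and> marked a ((\<lambda>j. x j) ` {..<n}) (x i)}
      \<in> sets (iid_uniform {..<n})"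
    using i by (intro measurable_marked measurable_iid_component) auto
  have E_eq: "E = {x \<in> space (iid_uniform {..<n}). inj_on (\<lambda>j. x j) {..<n} \<and> marked a ((\<lambda>j. x j) ` {..<n}) (x i)} \<inter>
      {x \<in> space (iid_uniform {..<n}). \<forall>j\<in>K. x j \<notin> A}"
    unfolding E_def marked_event_def K_def by blast
  have "{x \<in> space (iid_uniform {..<n}). \<forall>j\<in>K. x j \<notin> A} \<in> sets (iid_uniform {..<n})"
    by (rule void) (simp add: K_def)
  with m have Em: "E \<in> sets (iid_uniform {..<n})"
    unfolding E_eq by (rule sets.Int)
  then show "marked_event a n i A \<in> sets (iid_uniform {..<n})" by (simp add: E_def)
  have Vm: "V \<in> sets (iid_uniform K)" unfolding V_def by (rule void) simp
  have V: "emeasure (iid_uniform K) V = ennreal ((1 - measure lborel A) ^ (n - 1))"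
  proof -
    have "V = {x \<in> space (iid_uniform K). \<forall>j\<in>K. x j \<in> {0..1} - A}"
      unfolding V_def by (auto simp: space_PiM space_unit_lborel PiE_iff)
    moreover have "{0..1} - A \<in> sets unit_borel" using A by auto
    ultimately have "measure (iid_uniform K) V = (\<Prod>j\<in>K. measure lborel ({0..1} - A))"
      using measure_iid_box(2)[OF K(1), of "\<lambda>_. {0..1} - A"] by simp
    then show ?thesis
      using A K by (simp add: finite_measure.emeasure_eq_measure[OF prob_space.finite_measure[OF prob_space_iid]]
        measure_lborel_unit del: sets_unit_borel_iff)
  qed
  have "emeasure (iid_uniform {..<n}) E = (\<integral>\<^sup>+x. indicator E x \<partial>iid_uniform (insert i K))"
    using Em K by simp
  also have "\<dots> = (\<integral>\<^sup>+x. (\<integral>\<^sup>+u. indicator E (x(i := u)) \<partial>unit_lborel) \<partial>iid_uniform K)"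
    using K Em by (intro iid.product_nn_integral_insert) auto
  also have "\<dots> = (\<integral>\<^sup>+x. ennreal (a / n) * indicator V x \<partial>iid_uniform K)"
  proof (rule nn_integral_cong_AE)
    \<comment> \<open>Ties among the other coordinates are negligible; without ties \<open>R\<close>
      has exactly \<open>n - 1\<close> elements, which is what makes the constant
      \<open>a / n\<close>.\<close>
    have "(\<integral>\<^sup>+u. indicator E (x(i := u)) \<partial>unit_lborel) = ennreal (a / n) * indicator V x"
      if x: "x \<in> space (iid_uniform K)" and inj: "inj_on x K" for x
    proof -
      define R where "R = x ` K"
      define B where "B = {u \<in> {0..1}. u \<notin> R \<and> marked a (insert u R) u}"
      have R: "finite R" "card R = n - 1" using K by (auto simp: R_def card_image[OF inj])
      have B: "B \<in> sets unit_borel" "emeasure lborel B = ennreal (a / n)"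
        using emeasure_marked_insert[OF R(1) a] R i by (simp_all add: B_def del: sets_unit_borel_iff)
      have "x(i := u) \<in> E \<longleftrightarrow> x \<in> V \<and> u \<in> B" if u: "u \<in> {0..1}" for u
      proof -
        have "x(i := u) \<in> space (iid_uniform {..<n})"
          using x u unfolding K(3)[symmetric] by (auto simp: space_PiM space_unit_lborel intro!: PiE_fun_upd)
        moreover have img: "(x(i := u)) ` {..<n} = insert u R"
          unfolding K(3)[symmetric] R_def using K(2) by (auto simp: image_iff)
        moreover have "inj_on (x(i := u)) {..<n} \<longleftrightarrow> u \<notin> R"
        proof -
          have "inj_on (x(i := u)) K" using inj K(2) by (auto simp: inj_on_def)
          moreover have "(x(i := u)) ` (K - {i}) = R" using K(2) by (auto simp: R_def image_iff)
          ultimately show ?thesis unfolding K(3)[symmetric] by (simp add: inj_on_insert)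
        qed
        moreover have "(\<forall>j\<in>{..<n} - {i}. (x(i := u)) j \<notin> A) \<longleftrightarrow> x \<in> V"
          using x by (auto simp: V_def K_def)
        ultimately show ?thesis
          using u unfolding E_def marked_event_def B_def by (simp, blast)
      qed
      then have "(\<integral>\<^sup>+u. indicator E (x(i := u)) \<partial>unit_lborel) =
          (\<integral>\<^sup>+u. indicator V x * indicator B u \<partial>unit_lborel)"
        by (intro nn_integral_cong) (auto simp: space_unit_lborel indicator_def)
      also have "\<dots> = indicator V x * emeasure unit_lborel B"
        using B(1) by (intro nn_integral_cmult_indicator) (simp add: sets_unit_lborel)
      also have "emeasure unit_lborel B = ennreal (a / n)"
        using emeasure_unit_lborel[OF B(1)] B(2) by simp
      finally show ?thesis unfolding mult.commute[of "ennreal (a / n)"] .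
    qed
    then show "AE x in iid_uniform K. (\<integral>\<^sup>+u. indicator E (x(i := u)) \<partial>unit_lborel) = ennreal (a / n) * indicator V x"
      using AE_iid_inj[OF K(1)] by (intro AE_mp[OF AE_iid_inj[OF K(1)] AE_I2]) blast
  qed
  also have "\<dots> = ennreal (a / n) * emeasure (iid_uniform K) V"
    by (rule nn_integral_cmult_indicator[OF Vm])
  also have "\<dots> = ennreal (a / n * (1 - measure lborel A) ^ (n - 1))"
    unfolding V using a measure_lborel_unit(1)[OF A] by (intro ennreal_mult[symmetric]) auto
  finally have "emeasure (iid_uniform {..<n}) E = ennreal (a / n * (1 - measure lborel A) ^ (n - 1))" .
  then show "measure (iid_uniform {..<n}) (marked_event a n i A) = a / n * (1 - measure lborel A) ^ (n - 1)"
    using a measure_lborel_unit(1)[OF A] by (simp add: measure_def E_def)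
qed

subsection \<open>The thinning\<close>

text \<open>For \<open>n\<close> uniform points with \<open>n \<ge> 2\<close> the individual marks
  have probability \<open>a / n\<close> each, so \<open>a\<close> is the probability of deleting one
  point and \<open>1 - a\<close> that of deleting all. One point alone has to be exempted, as its
  mark would delete it.\<close>

definition thin_set :: "real \<Rightarrow> real set \<Rightarrow> real set" where
  "thin_set a S = (if card S = 1 then S
     else if \<exists>x\<in>S. marked a S x then {x \<in> S. \<not> marked a S x} else {})"

definition thin_map :: "(nat \<Rightarrow> real) \<Rightarrow> real measure \<Rightarrow> real measure" where
  "thin_map \<alpha> \<nu> = config (thin_set (\<alpha> (card (points \<nu>))) (points \<nu>))"

lemma thin_set_subset: "thin_set a S \<subseteq> S"
  by (auto simp: thin_set_def)

lemma thin_map_simps: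
  assumes "\<nu> \<in> simple_point_measures"
  shows "thin_map \<alpha> \<nu> \<in> simple_point_measures"
    and "points (thin_map \<alpha> \<nu>) = thin_set (\<alpha> (card (points \<nu>))) (points \<nu>)"
proof -
  have "finite (thin_set (\<alpha> (card (points \<nu>))) (points \<nu>))" "thin_set (\<alpha> (card (points \<nu>))) (points \<nu>) \<subseteq> {0..1}"
    using finite_subset[OF thin_set_subset finite_points[OF assms]]
      subset_trans[OF thin_set_subset points_subset] by simp_all
  then show "thin_map \<alpha> \<nu> \<in> simple_point_measures"
    and "points (thin_map \<alpha> \<nu>) = thin_set (\<alpha> (card (points \<nu>))) (points \<nu>)"
    unfolding thin_map_def by (rule config_in_simple_point_measures, intro points_config)
qed

text \<open>Written as the negation of a hitting event: this form also covers the case without a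
  mark, where nothing survives, and it decomposes into events that are disjoint for different
  \<open>i\<close>.\<close>

lemma thin_set_void_iff:
  assumes I: "finite I" "card I \<noteq> 1" and x: "inj_on x I" and a: "0 \<le> a"
  shows "thin_set a (x ` I) \<inter> A = {} \<longleftrightarrow> \<not> (\<exists>i\<in>I. marked a (x ` I) (x i) \<and> (\<exists>j\<in>I - {i}. x j \<in> A))"
proof (cases "\<exists>i\<in>I. marked a (x ` I) (x i)")
  case True
  then obtain i where i: "i \<in> I" "marked a (x ` I) (x i)" by blast
  have un: "j = i" if "j \<in> I" "marked a (x ` I) (x j)" for j
    using marked_unique[of "x ` I" a "x i" "x j"] I(1) a i that x by (auto simp: inj_on_def)
  have "thin_set a (x ` I) = {y \<in> x ` I. \<not> marked a (x ` I) y}"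
    using True I card_image[OF x] by (auto simp: thin_set_def)
  also have "\<dots> = x ` (I - {i})"
    using un i(2) by blast
  finally have "thin_set a (x ` I) \<inter> A = {} \<longleftrightarrow> \<not> (\<exists>j\<in>I - {i}. x j \<in> A)"
    by auto
  moreover have "(\<exists>k\<in>I. marked a (x ` I) (x k) \<and> (\<exists>j\<in>I - {k}. x j \<in> A)) \<longleftrightarrow> (\<exists>j\<in>I - {i}. x j \<in> A)"
    using un i by metis
  ultimately show ?thesis by simp
next
  case False
  then have "thin_set a (x ` I) = {}"
    using I card_image[OF x] by (auto simp: thin_set_def)
  with False show ?thesis by auto
qed

section \<open>Measurability of the thinning\<close>

lemma measurable_cdf:
  assumes "t \<in> {0..1}"
  shows "(\<lambda>\<nu>. measure \<nu> {0..t}) \<in> borel_measurable point_space"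
proof -
  have [measurable]: "(\<lambda>\<nu>. emeasure \<nu> {0..t}) \<in> borel_measurable point_space"
    using assms by (intro measurable_count) simp
  show ?thesis
    unfolding measure_def by measurable
qed

lemma measurable_order_stat: "(\<lambda>\<nu>. order_stat \<nu> i) \<in> borel_measurable point_space"
proof (rule borel_measurableI_le)
  fix t :: real
  have os: "order_stat \<nu> i \<in> {0..1}" if "\<nu> \<in> space point_space" for \<nu>
    using order_stat_le_iff(2)[of \<nu> 0 i] that by (simp add: space_point_space)
  consider "t < 0" | "t \<ge> 1" | "t \<in> {0..1}" by fastforce
  then show "{\<nu> \<in> space point_space. order_stat \<nu> i \<le> t} \<in> sets point_space"
  proof cases
    case 1
    then have "{\<nu> \<in> space point_space. order_stat \<nu> i \<le> t} = {}"
      using os by fastforce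
    then show ?thesis by (simp only: sets.empty_sets)
  next
    case 2
    then have "{\<nu> \<in> space point_space. order_stat \<nu> i \<le> t} = space point_space"
      using os by fastforce
    then show ?thesis by (simp only: sets.top)
  next
    case 3
    have [measurable]: "(\<lambda>\<nu>. measure \<nu> {0..t}) \<in> borel_measurable point_space"
      "(\<lambda>\<nu>. measure \<nu> {0..1}) \<in> borel_measurable point_space"
      using 3 by (simp_all add: measurable_cdf)
    have "{\<nu> \<in> space point_space. real (Suc i) \<le> measure \<nu> {0..t} \<or> measure \<nu> {0..1} < real (Suc i)}
        \<in> sets point_space"
      by measurable
    also have "{\<nu> \<in> space point_space. real (Suc i) \<le> measure \<nu> {0..t} \<or> measure \<nu> {0..1} < real (Suc i)} =
        {\<nu> \<in> space point_space. order_stat \<nu> i \<le> t}"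
      using order_stat_le_iff(1)[OF _ 3] unfolding space_point_space by blast
    finally show ?thesis .
  qed
qed

text \<open>The order statistics enumerate the points measurably and without repetition. Once the
  number of points is fixed, each void event of the image is therefore a finite Boolean combination
  of measurable conditions on them.\<close>

lemma measurable_thin_map:
  assumes \<alpha>: "range \<alpha> \<subseteq> {0..1}"
  shows "thin_map \<alpha> \<in> measurable point_space point_space"
proof (rule measurable_point_spaceI)
  show "thin_map \<alpha> \<nu> \<in> simple_point_measures" if "\<nu> \<in> space point_space" for \<nu>
    using that by (simp add: thin_map_simps space_point_space)
  fix A assume A: "A \<in> sets unit_borel"
  have [measurable]: "A \<in> sets borel" using A by simp
  have [measurable]: "(\<lambda>\<nu>. measure \<nu> {0..1}) \<in> borel_measurable point_space"
    by (rule measurable_cdf) simp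
  define H where "H n i j = {\<nu> \<in> space point_space.
      (inj_on (\<lambda>j. order_stat \<nu> j) {..<n} \<and> marked (\<alpha> n) ((\<lambda>j. order_stat \<nu> j) ` {..<n}) (order_stat \<nu> i)) \<and>
      order_stat \<nu> j \<in> A}" for n i j
  have H: "H n i j \<in> sets point_space" if "i < n" for n i j
  proof -
    have "{\<nu> \<in> space point_space. inj_on (\<lambda>j. order_stat \<nu> j) {..<n} \<and>
        marked (\<alpha> n) ((\<lambda>j. order_stat \<nu> j) ` {..<n}) (order_stat \<nu> i)} \<in> sets point_space"
      using that by (intro measurable_marked measurable_order_stat) auto
    moreover have [measurable]: "(\<lambda>\<nu>. order_stat \<nu> j) \<in> borel_measurable point_space"
      by (rule measurable_order_stat)
    have "{\<nu> \<in> space point_space. order_stat \<nu> j \<in> A} \<in> sets point_space"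
      by measurable
    moreover have "H n i j = {\<nu> \<in> space point_space. inj_on (\<lambda>j. order_stat \<nu> j) {..<n} \<and>
        marked (\<alpha> n) ((\<lambda>j. order_stat \<nu> j) ` {..<n}) (order_stat \<nu> i)} \<inter>
        {\<nu> \<in> space point_space. order_stat \<nu> j \<in> A}"
      unfolding H_def by blast
    ultimately show ?thesis by (simp only: sets.Int)
  qed
  \<comment> \<open>\<open>G n\<close> is meant to agree with the void event of the image only on
    configurations with \<open>n\<close> points; it is cut down to these when the union over
    \<open>n\<close> is taken.\<close>
  define G where "G n = (if n = 1 then {\<nu> \<in> simple_point_measures. emeasure \<nu> A = 0}
      else space point_space - (\<Union>i\<in>{..<n}. \<Union>j\<in>{..<n} - {i}. H n i j))" for n :: nat
  have G: "G n \<in> sets point_space" for n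
  proof (cases "n = 1")
    case True
    then show ?thesis using void_event_in_sets[OF A] by (simp add: G_def)
  next
    case False
    have "(\<Union>i\<in>{..<n}. \<Union>j\<in>{..<n} - {i}. H n i j) \<in> sets point_space"
      using H by (intro sets.finite_UN) auto
    then show ?thesis using False by (simp add: G_def sets.compl_sets)
  qed
  have N: "{\<nu> \<in> space point_space. measure \<nu> {0..1} = real n} \<in> sets point_space" for n
    by measurable
  have "(emeasure (thin_map \<alpha> \<nu>) A = 0) \<longleftrightarrow> \<nu> \<in> G (num_points \<nu>)" if \<nu>: "\<nu> \<in> simple_point_measures" for \<nu>
  proof -
    let ?n = "num_points \<nu>"
    have \<alpha>n: "0 \<le> \<alpha> ?n" using \<alpha> by (auto simp: image_subset_iff)
    have pts: "points \<nu> = order_stat \<nu> ` {..<?n}" by (rule points_eq_order_stat[OF \<nu>])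
    have inj: "inj_on (order_stat \<nu>) {..<?n}" by (rule inj_on_order_stat[OF \<nu>])
    have card: "card (points \<nu>) = ?n" by (simp add: pts card_image[OF inj])
    have "emeasure (thin_map \<alpha> \<nu>) A = 0 \<longleftrightarrow> thin_set (\<alpha> ?n) (points \<nu>) \<inter> A = {}"
      using emeasure_eq_0_iff_points[OF thin_map_simps(1)[OF \<nu>] A] by (simp add: thin_map_simps(2)[OF \<nu>] card)
    also have "\<dots> \<longleftrightarrow> \<nu> \<in> G ?n"
    proof (cases "?n = 1")
      case True
      then show ?thesis
        using \<nu> emeasure_eq_0_iff_points[OF \<nu> A] card by (simp add: G_def thin_set_def)
    next
      case False
      then show ?thesis
        using thin_set_void_iff[of "{..<?n}" "order_stat \<nu>" "\<alpha> ?n" A] \<alpha>n inj \<nu>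
        by (auto simp: G_def H_def pts space_point_space)
    qed
    finally show ?thesis .
  qed
  then have "{\<nu> \<in> space point_space. emeasure (thin_map \<alpha> \<nu>) A = 0} =
      (\<Union>n. {\<nu> \<in> space point_space. measure \<nu> {0..1} = real n} \<inter> G n)"
    using measure_num_points by (auto simp: space_point_space)
  also have "\<dots> \<in> sets point_space"
    using N G by (intro sets.countable_UN) auto
  finally show "{\<nu> \<in> space point_space. emeasure (thin_map \<alpha> \<nu>) A = 0} \<in> sets point_space" .
qed

section \<open>Void probabilities of the thinned process\<close>

lemma thin_void_event_in_sets:
  assumes \<alpha>: "range \<alpha> \<subseteq> {0..1}" and A: "A \<in> sets unit_borel"
  shows "{\<nu> \<in> simple_point_measures. emeasure (thin_map \<alpha> \<nu>) A = 0} \<in> sets point_space"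
proof -
  have [measurable]: "(\<lambda>\<nu>. emeasure (thin_map \<alpha> \<nu>) A) \<in> borel_measurable point_space"
    using measurable_comp[OF measurable_thin_map[OF \<alpha>] measurable_count[OF A]] by (simp add: o_def)
  have "{\<nu> \<in> space point_space. emeasure (thin_map \<alpha> \<nu>) A = 0} \<in> sets point_space"
    by measurable
  then show ?thesis by (simp add: space_point_space)
qed

text \<open>For at least two points the image behaves like \<open>n - 1\<close> uniform points with
  probability \<open>\<alpha> n\<close> and is empty otherwise. The formula is the complementary
  probability of hitting \<open>A\<close>, summed over the \<open>n\<close> possible marked
  coordinates.\<close>

lemma config_law_thin_void:
  assumes \<alpha>: "range \<alpha> \<subseteq> {0..1}" and A: "A \<in> sets unit_borel"
  shows "measure (config_law n) {\<nu> \<in> simple_point_measures. emeasure (thin_map \<alpha> \<nu>) A = 0} =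
    (if n = 0 then 1 else if n = 1 then 1 - measure lborel A
     else 1 - \<alpha> n * (1 - (1 - measure lborel A) ^ (n - 1)))"
proof -
  have \<alpha>n: "0 \<le> \<alpha> n" "\<alpha> n \<le> 1" using \<alpha> by (auto simp: image_subset_iff)
  let ?P = "iid_uniform {..<n}"
  have fin: "finite_measure ?P" by (rule prob_space.finite_measure[OF prob_space_iid])
  let ?V = "{\<nu> \<in> simple_point_measures. emeasure (thin_map \<alpha> \<nu>) A = 0}"
  let ?W = "{x \<in> space ?P. emeasure (thin_map \<alpha> (config (x ` {..<n}))) A = 0}"
  note Vm = thin_void_event_in_sets[OF \<alpha> A]
  have V: "measure (config_law n) ?V = measure ?P ?W"
    by (rule measure_config_law[OF Vm])
  have W: "emeasure (thin_map \<alpha> (config (x ` {..<n}))) A = 0 \<longleftrightarrow>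
      thin_set (\<alpha> (card (x ` {..<n}))) (x ` {..<n}) \<inter> A = {}" if x: "x \<in> space ?P" for x
  proof -
    have s: "config (x ` {..<n}) \<in> simple_point_measures" "points (config (x ` {..<n})) = x ` {..<n}"
      using image_iid[OF x] by (auto intro!: config_in_simple_point_measures points_config)
    then show ?thesis
      using emeasure_eq_0_iff_points[OF thin_map_simps(1)[OF s(1)] A] by (simp add: thin_map_simps(2)[OF s(1)])
  qed
  show ?thesis
  proof (cases "n = 1")
    case True
    have "thin_set (\<alpha> (card (x ` {..<n}))) (x ` {..<n}) = x ` {..<n}" for x :: "nat \<Rightarrow> real"
      by (simp add: True thin_set_def lessThan_Suc)
    then have "?W = {x \<in> space ?P. emeasure (config (x ` {..<n})) A = 0}"
      using W image_iid[of _ "{..<n}"] A by (intro Collect_cong conj_cong refl) (simp add: emeasure_config_eq_0_iff)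
    then have "measure ?P ?W = measure (config_law n) {\<nu> \<in> simple_point_measures. emeasure \<nu> A = 0}"
      using measure_config_law[OF void_event_in_sets[OF A], of n] by simp
    then show ?thesis using V config_law_void[OF A, of n] True by simp
  next
    case False
    \<comment> \<open>Coordinate \<open>i\<close> is marked and some surviving coordinate lies in
      \<open>A\<close>. Uniqueness of the mark makes these events disjoint.\<close>
    define F where "F i = marked_event (\<alpha> n) n i {} - marked_event (\<alpha> n) n i A" for i
    have ms: "marked_event (\<alpha> n) n i {} \<in> sets ?P" "marked_event (\<alpha> n) n i A \<in> sets ?P" if "i < n" for i
      using that marked_event_prob(1)[OF \<alpha>n that] A by auto
    have F: "F i \<in> sets ?P" "measure ?P (F i) = \<alpha> n / n * (1 - (1 - measure lborel A) ^ (n - 1))" if "i < n" for i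
    proof -
      show "F i \<in> sets ?P" using ms[OF that] by (simp add: F_def)
      have "marked_event (\<alpha> n) n i A \<subseteq> marked_event (\<alpha> n) n i {}"
        by (auto simp: marked_event_def)
      then have "measure ?P (F i) = measure ?P (marked_event (\<alpha> n) n i {}) - measure ?P (marked_event (\<alpha> n) n i A)"
        unfolding F_def using ms[OF that] by (intro finite_measure.finite_measure_Diff[OF fin])
      then show "measure ?P (F i) = \<alpha> n / n * (1 - (1 - measure lborel A) ^ (n - 1))"
        using marked_event_prob(2)[OF \<alpha>n that A] marked_event_prob(2)[OF \<alpha>n that, of "{}"]
        by (simp add: right_diff_distrib)
    qed
    have F_iff: "x \<in> F i \<longleftrightarrow> x \<in> space ?P \<and> (inj_on x {..<n} \<and> marked (\<alpha> n) (x ` {..<n}) (x i)) \<and>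
        (\<exists>j\<in>{..<n} - {i}. x j \<in> A)" for x i
      unfolding F_def marked_event_def by blast
    have Um: "(\<Union>i\<in>{..<n}. F i) \<in> sets ?P" using F(1) by (intro sets.finite_UN) auto
    have "measure ?P (\<Union>i\<in>{..<n}. F i) = (\<Sum>i<n. measure ?P (F i))"
    proof (rule finite_measure.finite_measure_finite_Union[OF fin])
      show "F ` {..<n} \<subseteq> sets ?P" using F(1) by auto
      show "disjoint_family_on F {..<n}"
        unfolding disjoint_family_on_def
      proof (intro ballI impI)
        fix i j assume ij: "i \<in> {..<n}" "j \<in> {..<n}" "i \<noteq> j"
        have False if "x \<in> F i" "x \<in> F j" for x
        proof -
          have "x i = x j"
            using that ij \<alpha>n(1) by (intro marked_unique[of "x ` {..<n}" "\<alpha> n"]) (auto simp: F_iff)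
          then show False using that ij by (auto simp: F_iff inj_on_def)
        qed
        then show "F i \<inter> F j = {}" by blast
      qed
    qed simp
    also have "\<dots> = (\<Sum>i<n. \<alpha> n / n * (1 - (1 - measure lborel A) ^ (n - 1)))"
      using F(2) by (intro sum.cong) auto
    finally have U: "measure ?P (\<Union>i\<in>{..<n}. F i) =
        (if n = 0 then 0 else \<alpha> n * (1 - (1 - measure lborel A) ^ (n - 1)))"
      by simp
    have "measure ?P ?W = measure ?P (space ?P - (\<Union>i\<in>{..<n}. F i))"
    proof (rule measure_eq_AE)
      show "AE x in ?P. x \<in> ?W \<longleftrightarrow> x \<in> space ?P - (\<Union>i\<in>{..<n}. F i)"
      proof (rule AE_mp[OF AE_iid_inj AE_I2, rule_format])
        fix x assume x: "x \<in> space ?P" and inj: "inj_on x {..<n}"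
        have "x \<in> ?W \<longleftrightarrow> thin_set (\<alpha> n) (x ` {..<n}) \<inter> A = {}"
          using W[OF x] x by (simp add: card_image[OF inj])
        also have "\<dots> \<longleftrightarrow> x \<in> space ?P - (\<Union>i\<in>{..<n}. F i)"
          using thin_set_void_iff[of "{..<n}" x "\<alpha> n" A] False inj \<alpha>n(1) x unfolding UN_iff Diff_iff F_iff by simp
        finally show "x \<in> ?W \<longleftrightarrow> x \<in> space ?P - (\<Union>i\<in>{..<n}. F i)" .
      qed simp
      have [measurable]: "(\<lambda>x. emeasure (thin_map \<alpha> (config (x ` {..<n}))) A) \<in> borel_measurable ?P"
        using measurable_comp[OF measurable_comp[OF measurable_config_image measurable_thin_map[OF \<alpha>]]
          measurable_count[OF A], of "{..<n}"] by (simp add: o_def)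
      show "?W \<in> sets ?P" by measurable
      show "space ?P - (\<Union>i\<in>{..<n}. F i) \<in> sets ?P" using Um by (rule sets.compl_sets)
    qed
    also have "\<dots> = 1 - measure ?P (\<Union>i\<in>{..<n}. F i)"
      using finite_measure.finite_measure_compl[OF fin Um] prob_space.prob_space[OF prob_space_iid] by simp
    finally show ?thesis unfolding V U using False by simp
  qed
qed

text \<open>The hypotheses balance the masses for every positive number of remaining points. The
  balance for the empty configuration then follows because \<open>p\<close> and \<open>q\<close>
  both sum to 1.\<close>

theorem thinning_thin_map:
  fixes r s :: real and \<alpha> :: "nat \<Rightarrow> real"
  defines "p \<equiv> \<lambda>n. r ^ n / fact n * exp (- r)" and "q \<equiv> \<lambda>n. s ^ n / fact n * exp (- s)"
  assumes r: "0 < r" and s: "0 < s" and \<alpha>: "range \<alpha> \<subseteq> {0..1}"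
    and \<alpha>2: "p 2 * \<alpha> 2 = q 1 - p 1" and \<alpha>3: "\<And>n. n \<ge> 2 \<Longrightarrow> p (Suc n) * \<alpha> (Suc n) = q n"
  shows "thinning r s (thin_map \<alpha>)"
proof -
  note fm = measurable_thin_map[OF \<alpha>]
  interpret L: prob_space "poisson_law r" by (rule prob_space_poisson_law)
  have void: "measure (poisson_law r) {\<nu> \<in> simple_point_measures. emeasure (thin_map \<alpha> \<nu>) A = 0} =
      exp (- (s * measure lborel A))" if A: "A \<in> sets unit_borel" for A
  proof -
    define b where "b = 1 - measure lborel A"
    define v where "v n = (if n = 0 then 1 else if n = 1 then b else 1 - \<alpha> n * (1 - b ^ (n - 1)))" for n
    have 1: "(\<lambda>n. p n * v n) sums measure (poisson_law r) {\<nu> \<in> simple_point_measures. emeasure (thin_map \<alpha> \<nu>) A = 0}"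
      using poisson_law_sums[OF r thin_void_event_in_sets[OF \<alpha> A]]
      unfolding config_law_thin_void[OF \<alpha> A] p_def v_def b_def .
    \<comment> \<open>The generic formula for \<open>m \<ge> 2\<close> is wrong at 0, where a single
      point is kept, and at 1, where the mass \<open>q 1\<close> comes partly from kept single
      points and partly from \<open>p 2\<close>. The two corrections cancel, because what
      \<open>p 1\<close> contributes is exactly what is missing from \<open>p 2\<close>.\<close>
    define d where "d m = (if m = 0 then - p 1 * (1 - b) else if m = 1 then p 1 * (1 - b) else 0)" for m :: nat
    have shift: "p (Suc m) * v (Suc m) = p (Suc m) - (q m - q m * b ^ m) + d m" for m
    proof -
      consider "m = 0" | "m = 1" | "m \<ge> 2" by linarith
      then show ?thesis
      proof cases
        case 2
        have "p 2 * v 2 = p 2 - p 2 * \<alpha> 2 * (1 - b)" by (simp add: v_def algebra_simps)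
        also have "\<dots> = p 2 - (q 1 - p 1) * (1 - b)" unfolding \<alpha>2 ..
        finally show ?thesis using 2 by (simp add: d_def numeral_2_eq_2 algebra_simps)
      next
        case 3
        have "p (Suc m) * (1 - \<alpha> (Suc m) * (1 - b ^ m)) = p (Suc m) - p (Suc m) * \<alpha> (Suc m) * (1 - b ^ m)"
          by (simp add: algebra_simps)
        then show ?thesis using \<alpha>3[OF 3] 3 by (simp add: v_def d_def algebra_simps)
      qed (simp add: v_def d_def algebra_simps)
    qed
    have "p sums 1" "q sums 1"
      using poisson_weights_sums[of r 1] poisson_weights_sums[of s 1] by (simp_all add: p_def q_def)
    moreover have "(\<lambda>m. q m * b ^ m) sums exp (- (s * (1 - b)))"
      unfolding q_def by (rule poisson_weights_sums)
    moreover have "d sums (\<Sum>m\<in>{0, 1}. d m)"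
      by (rule sums_finite) (auto simp: d_def)
    ultimately have "(\<lambda>m. p (Suc m) - (q m - q m * b ^ m) + d m) sums
        ((1 - p 0) - (1 - exp (- (s * (1 - b)))) + (\<Sum>m\<in>{0, 1}. d m))"
      by (intro sums_add sums_diff) (simp_all add: sums_Suc_iff)
    then have "(\<lambda>m. p (Suc m) * v (Suc m)) sums (exp (- (s * (1 - b))) - p 0)"
      unfolding shift by (simp add: d_def)
    then have 2: "(\<lambda>n. p n * v n) sums exp (- (s * (1 - b)))"
      by (subst (asm) sums_Suc_iff) (simp add: v_def)
    from sums_unique2[OF 1 2] show ?thesis by (simp add: b_def)
  qed
  have law: "poisson_process s (poisson_law r) (thin_map \<alpha>)"
  proof (rule poisson_process_if_void(2)[OF s])
    show "prob_space (poisson_law r)" by (rule L.prob_space_axioms)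
    show "thin_map \<alpha> \<in> measurable (poisson_law r) point_space"
      using fm measurable_cong_sets[OF sets_poisson_law refl] by blast
    fix A assume "A \<in> sets unit_borel"
    then show "measure (poisson_law r) {\<nu> \<in> space (poisson_law r). emeasure (thin_map \<alpha> \<nu>) A = 0} =
        exp (- (s * measure lborel A))"
      using void space_poisson_law by simp
  qed
  show ?thesis
    unfolding thinning_def
  proof (intro conjI allI impI)
    show "thin_map \<alpha> \<in> measurable point_space point_space" by (rule fm)
    \<comment> \<open>Every process of intensity \<open>r\<close> has the law
      \<open>poisson_law r\<close>, so the result for the canonical process transfers; the inclusion
      of points holds surely.\<close>
    fix M :: "real measure measure" and X assume X: "poisson_process r M X"
    then have M: "prob_space M" "X \<in> measurable M point_space" by (auto simp: poisson_process_def)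
    show "poisson_process s M (\<lambda>\<omega>. thin_map \<alpha> (X \<omega>))"
      using law unfolding poisson_process_distr[OF r X, symmetric] poisson_process_distr_iff[OF M fm] .
    show "AE \<omega> in M. points (thin_map \<alpha> (X \<omega>)) \<subseteq> points (X \<omega>)"
      using measurable_space[OF M(2)]
      by (intro AE_I2) (simp add: thin_map_simps(2) thin_set_subset space_point_space)
  qed
qed

subsection \<open>An obstruction\<close>

lemma config_law_0:
  assumes E: "E \<in> sets point_space" and e: "config {} \<in> E"
  shows "measure (config_law 0) E = 1"
proof -
  have "E = {\<nu> \<in> simple_point_measures. \<nu> \<in> E}"
    using sets.sets_into_space[OF E] by (auto simp: space_point_space)
  then have "measure (config_law 0) E = measure (iid_uniform {..<0::nat})
      {x \<in> space (iid_uniform {..<0::nat}). config (x ` {..<0::nat}) \<in> E}"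
    using measure_config_law[of "\<lambda>\<nu>. \<nu> \<in> E" 0] E by simp
  also have "{x \<in> space (iid_uniform {..<0::nat}). config (x ` {..<0::nat}) \<in> E} = space (iid_uniform {..<0::nat})"
    using e by simp
  finally show ?thesis
    by (simp only: prob_space.prob_space[OF prob_space_iid])
qed

lemma measurable_config_singleton: "(\<lambda>u. config {u}) \<in> measurable unit_lborel point_space"
proof (rule measurable_point_spaceI)
  show "config {u} \<in> simple_point_measures" if "u \<in> space unit_lborel" for u
    using that by (intro config_in_simple_point_measures) (auto simp: space_unit_lborel)
  fix A assume A: "A \<in> sets unit_borel"
  have "{u \<in> space unit_lborel. emeasure (config {u}) A = 0} = {0..1} - A"
    using A by (auto simp: space_unit_lborel emeasure_config_eq_0_iff)
  then show "{u \<in> space unit_lborel. emeasure (config {u}) A = 0} \<in> sets unit_lborel"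
    using A by (auto simp: sets_unit_lborel)
qed

lemma config_law_1:
  assumes E: "E \<in> sets point_space"
  shows "{u \<in> {0..1}. config {u} \<in> E} \<in> sets unit_borel"
    and "measure (config_law 1) E = measure lborel {u \<in> {0..1}. config {u} \<in> E}"
proof -
  let ?U = "{u \<in> {0..1}. config {u} \<in> E}"
  have U: "?U \<in> sets unit_lborel"
    using measurable_sets[OF measurable_config_singleton E]
    by (simp add: space_unit_lborel vimage_def Int_def conj_commute)
  then show U': "?U \<in> sets unit_borel" by (simp only: sets_unit_lborel)
  have one: "{..<1} = {0::nat}" by auto
  have m: "(\<lambda>x. config (x ` {..<1::nat})) \<in> measurable (iid_uniform {0}) point_space"
    using measurable_config_image[of "{0::nat}"] unfolding one by simp
  have "emeasure (config_law 1) E =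
      emeasure (iid_uniform {0::nat}) ((\<lambda>x. config (x ` {..<1})) -` E \<inter> space (iid_uniform {0}))"
    unfolding config_law_def one using m[unfolded one] E by (rule emeasure_distr)
  also have "(\<lambda>x. config (x ` {..<1::nat})) -` E \<inter> space (iid_uniform {0}) =
      (\<lambda>x. x 0) -` ?U \<inter> space (iid_uniform {0})"
  proof (rule set_eqI)
    fix x :: "nat \<Rightarrow> real"
    have "x 0 \<in> {0..1}" if "x \<in> space (iid_uniform {0})"
      using image_iid[OF that] by blast
    then show "x \<in> (\<lambda>x. config (x ` {..<1::nat})) -` E \<inter> space (iid_uniform {0}) \<longleftrightarrow>
        x \<in> (\<lambda>x. x 0) -` ?U \<inter> space (iid_uniform {0})"
      unfolding one by (simp only: vimage_def Int_iff mem_Collect_eq image_insert image_empty) blast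
  qed
  also have "emeasure (iid_uniform {0::nat}) \<dots> = emeasure (distr (iid_uniform {0::nat}) unit_lborel (\<lambda>x. x 0)) ?U"
    using U by (intro emeasure_distr[symmetric] measurable_component_singleton) auto
  also have "distr (iid_uniform {0::nat}) unit_lborel (\<lambda>x. x 0) = unit_lborel"
    by (rule iid.distr_singleton)
  finally show "measure (config_law 1) E = measure lborel ?U"
    using emeasure_unit_lborel[OF U'] by (simp add: measure_def)
qed

text \<open>Only the terms for no point and for one point are retained. The obstruction lives on
  these configurations, where a deterministic map has no spare randomness.\<close>

lemma poisson_law_lower_bound:
  assumes r: "0 < r" and E: "E \<in> sets point_space"
  shows "exp (- r) * measure (config_law 0) E + r * exp (- r) * measure (config_law 1) E \<le>
    measure (poisson_law r) E"
proof -
  let ?f = "\<lambda>n. r ^ n / fact n * exp (- r) * measure (config_law n) E"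
  have sums: "?f sums measure (poisson_law r) E" by (rule poisson_law_sums[OF r E])
  have "sum ?f {..<2} \<le> suminf ?f"
    using r by (intro sum_le_suminf sums_summable[OF sums]) auto
  then show ?thesis
    using sums_unique[OF sums] by (simp add: numeral_2_eq_2)
qed

theorem no_thinning:
  assumes r: "0 < r"
    and 1: "s * exp (- s) < r * exp (- r)" and 0: "exp (- s) < exp (- r) + r * exp (- r)"
  shows "\<not> thinning r s f"
proof
  assume f: "thinning r s f"
  let ?P = "poisson_law r"
  interpret P: prob_space ?P by (rule prob_space_poisson_law)
  have fm: "f \<in> measurable point_space point_space" using f by (simp add: thinning_def)
  have pp: "poisson_process s ?P f" and ae: "AE \<nu> in ?P. points (f \<nu>) \<subseteq> points \<nu>"
    using thinning_any_space[OF f poisson_process_law[OF r]] by auto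
  have fS: "f \<nu> \<in> simple_point_measures" if "\<nu> \<in> simple_point_measures" for \<nu>
    using measurable_space[OF fm] that by (simp add: space_point_space)
  have cnt: "(\<lambda>\<nu>. emeasure (f \<nu>) A) \<in> borel_measurable point_space" if "A \<in> sets unit_borel" for A
    using measurable_comp[OF fm measurable_count[OF that]] by (simp add: o_def)
  have unit: "{0..1} \<in> sets unit_borel" by simp
  have c0: "config {} \<in> simple_point_measures" "points (config {}) = {}"
    by (simp_all add: config_in_simple_point_measures points_config)
  have c1: "config {u} \<in> simple_point_measures" "points (config {u}) = {u}" if "u \<in> {0..1}" for u
    using that by (simp_all add: config_in_simple_point_measures points_config)

  \<comment> \<open>Deletion is only known almost surely. As the configurations of zero and of one
    point carry positive weight, the exceptional set cannot contain the empty configuration, and it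
    contains single points only for a null set \<open>Z\<close> of positions.\<close>
  obtain N where N: "{\<nu> \<in> space ?P. \<not> points (f \<nu>) \<subseteq> points \<nu>} \<subseteq> N" "emeasure ?P N = 0" "N \<in> sets ?P"
    using ae by (rule AE_E)
  then have NS: "N \<in> sets point_space" by simp
  define Z where "Z = {u \<in> {0..1}. config {u} \<in> N}"
  have "exp (- r) * measure (config_law 0) N + r * exp (- r) * measure (config_law 1) N \<le> 0"
    using poisson_law_lower_bound[OF r NS] N(2) by (simp add: measure_def)
  moreover have "0 \<le> exp (- r) * measure (config_law 0) N" "0 \<le> r * exp (- r) * measure (config_law 1) N"
    using r by simp_all
  ultimately have "exp (- r) * measure (config_law 0) N = 0" "r * exp (- r) * measure (config_law 1) N = 0"
    by linarith+
  then have N0: "measure (config_law 0) N = 0" and N1: "measure (config_law 1) N = 0"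
    using r by simp_all
  have e: "config {} \<notin> N" using config_law_0[OF NS] N0 by auto
  have Z: "Z \<in> sets unit_borel" "measure lborel Z = 0"
    using config_law_1[OF NS] N1 unfolding Z_def by simp_all
  have sub: "points (f (config {u})) \<subseteq> {u}" if "u \<in> {0..1}" "u \<notin> Z" for u
    using that N(1) c1[OF that(1)] by (auto simp: Z_def)

  have full: "{\<nu> \<in> simple_point_measures. emeasure (f \<nu>) {0..1} = 0} \<in> sets point_space"
    (is "?E0 \<in> _")
  proof -
    have [measurable]: "(\<lambda>\<nu>. emeasure (f \<nu>) {0..1}) \<in> borel_measurable point_space" by (rule cnt[OF unit])
    have "{\<nu> \<in> space point_space. emeasure (f \<nu>) {0..1} = 0} \<in> sets point_space" by measurable
    then show ?thesis by (simp add: space_point_space)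
  qed
  \<comment> \<open>\<open>B\<close> collects the positions at which a single point is deleted; at
    almost every position of \<open>A\<close> it is kept.\<close>
  define B where "B = {u \<in> {0..1}. config {u} \<in> ?E0}"
  define A where "A = {0..1} - B"
  have B: "B \<in> sets unit_borel" "measure (config_law 1) ?E0 = measure lborel B"
    using config_law_1[OF full] unfolding B_def by blast+
  have A: "A \<in> sets unit_borel" using B(1) by (auto simp: A_def)
  have Ac: "{0..1} - A = B" using B(1) by (auto simp: A_def)
  have mB: "measure lborel B = 1 - measure lborel A" using measure_lborel_unit(2)[OF A] by (simp add: Ac)

  have cA: "measure ?P {\<nu> \<in> space ?P. emeasure (f \<nu>) C = of_nat n} =
      (s * measure lborel C) ^ n / fact n * exp (- (s * measure lborel C))" if "C \<in> sets unit_borel" for C n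
    using pp that unfolding poisson_process_def by blast

  have "measure lborel A = 0"
  proof (rule ccontr)
    assume nz: "measure lborel A \<noteq> 0"
    \<comment> \<open>The event is one image point in \<open>A\<close> and none in the complement
      \<open>B\<close>. Independence of the two counts turns its probability into
      \<open>s * exp (- s)\<close> times the measure of \<open>A\<close>, linear in that measure and
      thus comparable with the mass of single points in \<open>A\<close>.\<close>
    let ?C = "\<lambda>i::nat. if i = 0 then A else B"
    let ?V = "\<lambda>i::nat. {of_nat (if i = 0 then 1 else 0)} :: ennreal set"
    let ?E1 = "{\<nu> \<in> simple_point_measures. emeasure (f \<nu>) A = 1 \<and> emeasure (f \<nu>) B = 0}"
    have E1: "?E1 \<in> sets point_space"
    proof -
      have [measurable]: "(\<lambda>\<nu>. emeasure (f \<nu>) A) \<in> borel_measurable point_space"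
        "(\<lambda>\<nu>. emeasure (f \<nu>) B) \<in> borel_measurable point_space" using cnt A B by blast+
      have "{\<nu> \<in> space point_space. emeasure (f \<nu>) A = 1 \<and> emeasure (f \<nu>) B = 0} \<in> sets point_space"
        by measurable
      then show ?thesis by (simp add: space_point_space)
    qed
    have "disjoint_family_on ?C {..<2}" by (auto simp: disjoint_family_on_def A_def)
    then have "P.indep_vars (\<lambda>_. borel) (\<lambda>i \<nu>. emeasure (f \<nu>) (?C i)) {..<2}"
      using pp A B(1) unfolding poisson_process_def by (auto simp del: sets_unit_borel_iff)
    then have "P.prob (\<Inter>i\<in>{..<2}. (\<lambda>\<nu>. emeasure (f \<nu>) (?C i)) -` ?V i \<inter> space ?P) =
        (\<Prod>i<2. P.prob ((\<lambda>\<nu>. emeasure (f \<nu>) (?C i)) -` ?V i \<inter> space ?P))"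
      by (rule P.indep_varsD) (auto simp: lessThan_empty_iff)
    also have "(\<Inter>i\<in>{..<2}. (\<lambda>\<nu>. emeasure (f \<nu>) (?C i)) -` ?V i \<inter> space ?P) = ?E1"
      by (auto simp: numeral_2_eq_2 lessThan_Suc)
    also have "(\<lambda>\<nu>. emeasure (f \<nu>) (?C i)) -` ?V i \<inter> space ?P =
        {\<nu> \<in> space ?P. emeasure (f \<nu>) (?C i) = of_nat (if i = 0 then 1 else 0)}" for i
      by auto
    then have "(\<Prod>i<2. P.prob ((\<lambda>\<nu>. emeasure (f \<nu>) (?C i)) -` ?V i \<inter> space ?P)) =
        (\<Prod>i<2. P.prob {\<nu> \<in> space ?P. emeasure (f \<nu>) (?C i) = of_nat (if i = 0 then 1 else 0)})"
      by simp
    also have "\<dots> = s * measure lborel A * exp (- (s * measure lborel A)) * exp (- (s * measure lborel B))"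
      using cA[OF A, of 1] cA[OF B(1), of 0] by (simp add: numeral_2_eq_2 lessThan_Suc)
    also have "\<dots> = s * exp (- s) * measure lborel A"
      by (simp add: mB algebra_simps flip: exp_add)
    finally have PE: "measure ?P ?E1 = s * exp (- s) * measure lborel A" .
    \<comment> \<open>For \<open>u\<close> in \<open>A\<close> outside \<open>Z\<close> the image of
      the single point \<open>u\<close> is nonempty and contained in that point, hence equal to
      it.\<close>
    have "measure lborel A \<le> measure lborel {u \<in> {0..1}. config {u} \<in> ?E1}"
    proof -
      have "u \<in> {u \<in> {0..1}. config {u} \<in> ?E1}" if u: "u \<in> A" "u \<notin> Z" for u
      proof -
        have u01: "u \<in> {0..1}" using u by (simp add: A_def)
        have fu: "f (config {u}) \<in> simple_point_measures" using fS c1(1)[OF u01] by blast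
        have "emeasure (f (config {u})) {0..1} \<noteq> 0"
          using u c1(1)[OF u01] by (auto simp: A_def B_def)
        then have "points (f (config {u})) \<noteq> {}"
          using emeasure_eq_0_iff_points[OF fu unit] by auto
        then have "points (f (config {u})) = {u}" using sub[OF u01 u(2)] by blast
        then have "emeasure (f (config {u})) A = 1" "emeasure (f (config {u})) B = 0"
          using emeasure_eq_card_points[OF fu A] emeasure_eq_card_points[OF fu B(1)] u(1)
          by (simp_all add: A_def)
        then show ?thesis using u01 c1(1)[OF u01] by simp
      qed
      then have "A \<subseteq> {u \<in> {0..1}. config {u} \<in> ?E1} \<union> Z" by blast
      then have "measure unit_lborel A \<le> measure unit_lborel ({u \<in> {0..1}. config {u} \<in> ?E1} \<union> Z)"
        using config_law_1(1)[OF E1] Z(1) by (intro unif.finite_measure_mono) (auto simp: sets_unit_lborel)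
      also have "\<dots> \<le> measure unit_lborel {u \<in> {0..1}. config {u} \<in> ?E1} + measure unit_lborel Z"
        using config_law_1(1)[OF E1] Z(1) by (intro measure_Un_le) (simp_all only: sets_unit_lborel)
      finally show ?thesis
        using measure_unit_lborel[OF A] measure_unit_lborel[OF Z(1)] measure_unit_lborel[OF config_law_1(1)[OF E1]]
        by (simp only: Z(2))
    qed
    also have "\<dots> = measure (config_law 1) ?E1"
      by (rule config_law_1(2)[OF E1, symmetric])
    finally have "r * exp (- r) * measure lborel A \<le> r * exp (- r) * measure (config_law 1) ?E1"
      using r by (intro mult_left_mono) simp_all
    also have "\<dots> \<le> exp (- r) * measure (config_law 0) ?E1 + r * exp (- r) * measure (config_law 1) ?E1"
      by simp
    also have "\<dots> \<le> measure ?P ?E1" by (rule poisson_law_lower_bound[OF r E1])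
    finally have "r * exp (- r) * measure lborel A \<le> s * exp (- s) * measure lborel A"
      unfolding PE .
    moreover have "measure lborel A > 0" using nz by (simp add: zero_less_measure_iff)
    ultimately show False using 1 by simp
  qed
  \<comment> \<open>The second alternative: almost all single points are deleted and the empty
    configuration stays empty, so the void event of the image receives all the mass of at most one
    point.\<close>
  then have "measure (config_law 1) ?E0 = 1" using B(2) mB by simp
  moreover have "measure (config_law 0) ?E0 = 1"
  proof (rule config_law_0[OF full])
    have "points (f (config {})) = {}" using N(1) e c0 by auto
    then show "config {} \<in> ?E0"
      using emeasure_eq_0_iff_points[OF fS[OF c0(1)] unit] c0(1) by simp
  qed
  ultimately have "exp (- r) + r * exp (- r) \<le> measure ?P ?E0"
    using poisson_law_lower_bound[OF r full] by simp
  also have "?E0 = {\<nu> \<in> space ?P. emeasure (f \<nu>) {0..1} = of_nat 0}" by simp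
  also have "measure ?P \<dots> = exp (- s)"
    using cA[OF unit, of 0] by simp
  finally show False using 0 by simp
qed

subsection \<open>The intensities 3/2, 13/20 and 3/5\<close>

text \<open>The intensity 3/5 is \<open>r / (1 + r)\<close> for \<open>r = 3/2\<close>. With this
  choice both hypotheses of \<open>no_thinning\<close> become the same inequality,
  \<open>exp (r - s) < 1 + r\<close>, which is the present one. It also serves as an upper bound for
  \<open>exp (17/20)\<close>.\<close>

lemma exp_nine_tenths: "exp (9 / 10 :: real) < 5 / 2"
proof -
  have "exp (9 / 10 :: real) ^ 10 = exp 1 ^ 9"
    by (simp flip: exp_of_nat_mult)
  also have "\<dots> < (272 / 100) ^ 9"
    using e_less_272 by (intro power_strict_mono) auto
  also have "\<dots> < (5 / 2 :: real) ^ 10" by (simp add: power_divide)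
  finally show ?thesis by (rule power_less_imp_less_base) simp
qed

text \<open>This is p 1 \<le> q 1 for the intensities 3/2 and 13/20, whose difference is 17/20 and
  whose ratio is 30/13. The margin is small: the quadratic Taylor bound fails at 17/20 and at half
  of it, so the exponent is divided by 4.\<close>

lemma exp_seventeen_twentieths: "30 / 13 \<le> exp (17 / 20 :: real)"
proof -
  have "30 / 13 \<le> (1 + 17 / 80 + (17 / 80)\<^sup>2 / 2 :: real) ^ 4" by (simp add: power_divide field_simps)
  also have "\<dots> \<le> exp (17 / 80) ^ 4"
    using exp_lower_Taylor_quadratic[of "17 / 80 :: real"] by (intro power_mono) auto
  also have "\<dots> = exp (17 / 20)" by (simp flip: exp_of_nat_mult)
  finally show ?thesis .
qed

text \<open>Up to the factor \<open>2 / 3 * exp (17/20)\<close>, the left side is the ratio of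
  \<open>q n\<close> to \<open>p (Suc n)\<close>, with 13/30 the ratio of the intensities. It
  decreases from its value 169/300 at \<open>n = 2\<close>.\<close>

lemma geometric_weight_bound: "n \<ge> 2 \<Longrightarrow> real (Suc n) * (13 / 30) ^ n \<le> 169 / 300"
proof (induction n rule: dec_induct)
  case (step n)
  have "real (Suc (Suc n)) * (13 / 30) ^ Suc n = real (n + 2) * (13 / 30) * (13 / 30) ^ n" by simp
  also have "\<dots> \<le> real (Suc n) * (13 / 30) ^ n" by (intro mult_right_mono) auto
  finally show ?case using step.IH by (rule order_trans)
qed (simp add: power2_eq_square)

lemma thinning_exists: "\<exists>f. thinning (3 / 2) (13 / 20) f"
proof -
  define p q :: "nat \<Rightarrow> real" where "p n = (3 / 2) ^ n / fact n * exp (- (3 / 2))"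
    and "q n = (13 / 20) ^ n / fact n * exp (- (13 / 20))" for n
  define \<alpha> where "\<alpha> n = (if n < 2 then 0 else if n = 2 then (q 1 - p 1) / p 2 else q (n - 1) / p n)" for n
  \<comment> \<open>This is the ratio of \<open>exp (- (13/20))\<close> to
    \<open>exp (- (3/2))\<close>. Pulling out the latter leaves inequalities that are linear in
    \<open>c\<close>.\<close>
  define c where "c = exp (17 / 20 :: real)"
  have c: "30 / 13 \<le> c" "c \<le> 5 / 2"
  proof -
    show "30 / 13 \<le> c" unfolding c_def by (rule exp_seventeen_twentieths)
    have "c \<le> exp (9 / 10)" by (simp add: c_def)
    then show "c \<le> 5 / 2" using exp_nine_tenths by simp
  qed
  have q: "q n = (13 / 20) ^ n / fact n * c * exp (- (3 / 2))" for n
    by (simp add: q_def c_def flip: exp_add)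
  have p: "p n > 0" for n by (simp add: p_def)
  have q0: "q n \<ge> 0" for n by (simp add: q_def)
  have "p 1 \<le> q 1" using c by (simp add: p_def q)
  moreover have "q 1 - p 1 \<le> p 2"
  proof -
    have "q 1 - p 1 = (13 / 20 * c - 3 / 2) * exp (- (3 / 2))" by (simp add: p_def q algebra_simps)
    also have "\<dots> \<le> 9 / 8 * exp (- (3 / 2))" using c by (intro mult_right_mono) auto
    also have "\<dots> = p 2" by (simp add: p_def power2_eq_square)
    finally show ?thesis .
  qed
  moreover have "q n \<le> p (Suc n)" if "n \<ge> 2" for n
  proof -
    \<comment> \<open>The right side is about 1.41, below the 3/2 needed for
      \<open>q n \<le> p (Suc n)\<close>, so the crude upper bound 5/2 for \<open>c\<close> is
      enough.\<close>
    have "c * (real (Suc n) * (13 / 30) ^ n) \<le> 5 / 2 * (169 / 300)"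
      using c geometric_weight_bound[OF that] by (intro mult_mono) auto
    then have "c * (real (Suc n) * (13 / 30) ^ n) \<le> 3 / 2" by simp
    then have "(3 / 2) ^ n / fact (Suc n) * exp (- (3 / 2)) * (c * (real (Suc n) * (13 / 30) ^ n)) \<le>
        (3 / 2) ^ n / fact (Suc n) * exp (- (3 / 2)) * (3 / 2)"
      by (intro mult_left_mono) auto
    moreover have "q n = (3 / 2) ^ n / fact (Suc n) * exp (- (3 / 2)) * (c * (real (Suc n) * (13 / 30) ^ n))"
    proof -
      have "x / (m * F) * E * (c * (m * y)) = x * y / F * c * E" if "m \<noteq> 0" for x y m F E :: real
        using that by simp
      from this[of "real (Suc n)"] show ?thesis
        unfolding q fact_Suc of_nat_mult by (simp del: of_nat_Suc flip: power_mult_distrib)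
    qed
    moreover have "p (Suc n) = (3 / 2) ^ n / fact (Suc n) * exp (- (3 / 2)) * (3 / 2)"
      by (simp add: p_def mult_ac)
    ultimately show ?thesis by simp
  qed
  ultimately have "0 \<le> \<alpha> n \<and> \<alpha> n \<le> 1" for n
    using p q0 by (cases n) (auto simp: \<alpha>_def divide_le_eq le_divide_eq less_imp_le not_le)
  then have \<alpha>: "range \<alpha> \<subseteq> {0..1}" by auto
  have "thinning (3 / 2) (13 / 20) (thin_map \<alpha>)"
  proof (rule thinning_thin_map[OF _ _ \<alpha>])
    show "(3 / 2) ^ 2 / fact 2 * exp (- (3 / 2)) * \<alpha> 2 =
        (13 / 20) ^ 1 / fact 1 * exp (- (13 / 20)) - (3 / 2) ^ 1 / fact 1 * exp (- (3 / 2))"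
      using p[of 2] unfolding p_def[symmetric] q_def[symmetric] by (simp add: \<alpha>_def)
    show "(3 / 2) ^ Suc n / fact (Suc n) * exp (- (3 / 2)) * \<alpha> (Suc n) =
        (13 / 20) ^ n / fact n * exp (- (13 / 20))" if "2 \<le> n" for n
      using p[of "Suc n"] that unfolding p_def[symmetric] q_def[symmetric] by (simp add: \<alpha>_def)
  qed simp_all
  then show ?thesis by blast
qed

theorem corollary3:
  shows "\<exists>(r::real) (s::real) (s'::real). r > s \<and> s > s' \<and> s' > 0 \<and>
           (\<exists>f. thinning r s f) \<and> \<not> (\<exists>f. thinning r s' f)"
proof (rule exI[of _ "3 / 2"], rule exI[of _ "13 / 20"], rule exI[of _ "3 / 5"], intro conjI)
  show "\<exists>f. thinning (3 / 2) (13 / 20) f" by (rule thinning_exists)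
  have "exp (- (3 / 5)) = exp (- (3 / 2)) * exp (9 / 10 :: real)"
    by (simp flip: exp_add)
  moreover have "exp (- (3 / 2)) * exp (9 / 10 :: real) < exp (- (3 / 2)) * (5 / 2)"
    using exp_nine_tenths by (intro mult_strict_left_mono) auto
  ultimately have "exp (- (3 / 5)) < exp (- (3 / 2)) * (5 / 2 :: real)" by simp
  then have "\<not> thinning (3 / 2) (3 / 5) f" for f
    by (intro no_thinning) auto
  then show "\<not> (\<exists>f. thinning (3 / 2) (3 / 5) f)" by blast
qed simp_all

end
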